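(* Let $D\subset B$ (proper inclusion) be a pair of integral domains sharing a common nonzero ideal $I$ (that is, $I$ is a nonzero ideal of both $D$ and $B$), and let $E$ be a nonempty subset of $K$, where $K$ is the quotient field of both $D$ and $B$. If $D/I$ is finite, then $$\dim(\mathrm{Int}^{\mathrm{R}}(E,D))\leqslant \dim(\mathrm{Int}^{\mathrm{R}}(E,B)).$$ If, moreover, $E$ is a fractional subset of $D$ contained in $B$, then $$1+\dim(D)\leqslant\dim(\mathrm{Int}^{\mathrm{R}}(E,D))\leqslant 1+\dim_v(B).$$
   Context: For an integral domain $R$ with quotient field $K$ and $E\subseteq K$, $\mathrm{Int}^{\mathrm{R}}(E,R)=\{\varphi\in K(X) : \varphi(E)\subseteq R\}$ is the ring of integer-valued rational functions on $E$ over $R$ (in particular $\varphi$ is required to be defined at each point of $E$). A subset $E$ of $K$ is a fractional subset of $D$ if there is a nonzero $d\in D$ with $dE\subseteq D$. $\dim$ denotes Krull dimension. The valuative dimension $\dim_v(R)$ of an integral domain $R$ is the supremum of the Krull dimensions of the valuation overrings of $R$ (valuation rings between $R$ and its quotient field). *)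

theory Defs
  imports
    "HOL-Algebra.Algebraic_Closure_Type"
    "HOL-Algebra.QuotRing"
    "HOL-Library.Extended_Nat"
begin

text \<open>
  The ambient field \<open>K\<close> is a type \<open>'k\<close> of class \<open>field\<close>, and the field \<open>K(X)\<close> of rational functions
  is \<open>'k poly fract\<close>. Subrings are sets of elements; \<open>ring_on S\<close> turns such a set into a ring in the
  sense of HOL-Algebra, so that \<open>ideal\<close>, \<open>primeideal\<close>, \<open>subdomain\<close> and \<open>Quot\<close> apply to it.
\<close>

abbreviation ring_on :: "'a::comm_ring_1 set \<Rightarrow> 'a ring" where
  "ring_on S \<equiv> ring_of_type_algebra \<lparr>carrier := S\<rparr>"

definition krull_dim :: "('a, 'b) ring_scheme \<Rightarrow> enat" where
  "krull_dim R = Sup {enat n | n. \<exists>P :: nat \<Rightarrow> 'a set.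
     (\<forall>i\<le>n. primeideal (P i) R) \<and> (\<forall>i<n. P i \<subset> P (Suc i))}"

definition quotient_field :: "'a::field set \<Rightarrow> 'a set" where
  "quotient_field R = {a / b | a b. a \<in> R \<and> b \<in> R \<and> b \<noteq> 0}"

definition valuation_ring :: "'a::field set \<Rightarrow> bool" where
  "valuation_ring V \<longleftrightarrow> subdomain V ring_of_type_algebra \<and>
     (\<forall>x\<in>quotient_field V. x \<noteq> 0 \<longrightarrow> x \<in> V \<or> inverse x \<in> V)"

definition valuation_overrings :: "'a::field set \<Rightarrow> 'a set set" where
  "valuation_overrings R = {V. valuation_ring V \<and> R \<subseteq> V \<and> V \<subseteq> quotient_field R}"

definition valuative_dim :: "'a::field set \<Rightarrow> enat" where
  "valuative_dim R = (SUP V \<in> valuation_overrings R. krull_dim (ring_on V))"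

text \<open>
  \<open>has_value \<phi> a y\<close>: the rational function \<open>\<phi>\<close> is defined at \<open>a\<close>, i.e. some representation of it as a
  fraction has a denominator not vanishing at \<open>a\<close>, and its value there is \<open>y\<close>.
\<close>

definition has_value :: "'k::field poly fract \<Rightarrow> 'k \<Rightarrow> 'k \<Rightarrow> bool" where
  "has_value \<phi> a y \<longleftrightarrow>
     (\<exists>p q. \<phi> = Fract p q \<and> poly q a \<noteq> 0 \<and> y = poly p a / poly q a)"

lemma has_value_unique:
  assumes "has_value \<phi> a y" "has_value \<phi> a z"
  shows "y = z"
proof -
  obtain p q where 1: "\<phi> = Fract p q" "poly q a \<noteq> 0" "y = poly p a / poly q a"
    using assms(1) unfolding has_value_def by blast
  obtain r s where 2: "\<phi> = Fract r s" "poly s a \<noteq> 0" "z = poly r a / poly s a"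
    using assms(2) unfolding has_value_def by blast
  have "q \<noteq> 0" "s \<noteq> 0" using 1(2) 2(2) by auto
  then have "p * s = r * q" using 1(1) 2(1) by (simp add: eq_fract)
  then have "poly p a * poly s a = poly r a * poly q a"
    by (metis poly_mult)
  then show ?thesis using 1 2 by (simp add: frac_eq_eq)
qed

text \<open>\<open>Int\<^sup>R(E,R)\<close>, for a domain \<open>R\<close> whose quotient field is the whole type \<open>'k\<close>.\<close>

definition int_rat :: "'k::field set \<Rightarrow> 'k set \<Rightarrow> 'k poly fract set" where
  "int_rat E R = {\<phi>. \<forall>a\<in>E. \<exists>y\<in>R. has_value \<phi> a y}"

definition fractional_subset :: "'k::field set \<Rightarrow> 'k set \<Rightarrow> bool" where
  "fractional_subset E D \<longleftrightarrow> (\<exists>d\<in>D. d \<noteq> 0 \<and> (\<forall>e\<in>E. d * e \<in> D))"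

lemma has_value_const: "has_value (Fract [:c:] 1) a c"
  unfolding has_value_def by (rule exI[of _ "[:c:]"], rule exI[of _ 1]) simp

lemma has_value_minus:
  assumes "has_value \<phi> a y" shows "has_value (- \<phi>) a (- y)"
proof -
  obtain p q where 1: "\<phi> = Fract p q" "poly q a \<noteq> 0" "y = poly p a / poly q a"
    using assms(1) unfolding has_value_def by blast
  show ?thesis unfolding has_value_def
    by (rule exI[of _ "- p"], rule exI[of _ q]) (use 1 in simp)
qed

lemma has_value_add:
  assumes "has_value \<phi> a y" "has_value \<psi> a z" shows "has_value (\<phi> + \<psi>) a (y + z)"
proof -
  obtain p q where 1: "\<phi> = Fract p q" "poly q a \<noteq> 0" "y = poly p a / poly q a"
    using assms(1) unfolding has_value_def by blast
  obtain r s where 2: "\<psi> = Fract r s" "poly s a \<noteq> 0" "z = poly r a / poly s a"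
    using assms(2) unfolding has_value_def by blast
  have "q \<noteq> 0" "s \<noteq> 0" using 1(2) 2(2) by auto
  then show ?thesis unfolding has_value_def
    by (intro exI[of _ "p * s + r * q"] exI[of _ "q * s"])
       (use 1 2 in \<open>simp add: add_frac_eq\<close>)
qed

lemma has_value_mult:
  assumes "has_value \<phi> a y" "has_value \<psi> a z" shows "has_value (\<phi> * \<psi>) a (y * z)"
proof -
  obtain p q where 1: "\<phi> = Fract p q" "poly q a \<noteq> 0" "y = poly p a / poly q a"
    using assms(1) unfolding has_value_def by blast
  obtain r s where 2: "\<psi> = Fract r s" "poly s a \<noteq> 0" "z = poly r a / poly s a"
    using assms(2) unfolding has_value_def by blast
  show ?thesis unfolding has_value_def
    by (intro exI[of _ "p * r"] exI[of _ "q * s"]) (use 1 2 in simp)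
qed

lemma subring_int_rat:
  assumes "subring R (ring_of_type_algebra :: 'k::field ring)"
  shows "subring (int_rat E R) ring_of_type_algebra"
proof -
  let ?K = "ring_of_type_algebra :: 'k ring"
  let ?L = "ring_of_type_algebra :: 'k poly fract ring"
  interpret K: ring ?K by (rule ring_from_type_algebra)
  interpret L: ring ?L by (rule ring_from_type_algebra)
  interpret R: subring R ?K by (rule assms)
  have uminus_K: "\<ominus>\<^bsub>?K\<^esub> x = - x" for x
    by (rule K.minus_equality) (simp_all add: ring_of_type_algebra_def)
  have uminus_L: "\<ominus>\<^bsub>?L\<^esub> x = - x" for x
    by (rule L.minus_equality) (simp_all add: ring_of_type_algebra_def)
  have one: "1 \<in> R" using R.one_closed by (simp add: ring_of_type_algebra_def)
  have mult: "x * y \<in> R" if "x \<in> R" "y \<in> R" for x y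
    using R.m_closed[OF that] by (simp add: ring_of_type_algebra_def)
  have add: "x + y \<in> R" if "x \<in> R" "y \<in> R" for x y
    using subringE(7)[OF assms that] by (simp add: ring_of_type_algebra_def)
  have minus: "- x \<in> R" if "x \<in> R" for x
    using subringE(5)[OF assms that] by (simp add: uminus_K)
  have int_rat_minus: "- f \<in> int_rat E R" if "f \<in> int_rat E R" for f
    unfolding int_rat_def
  proof (intro CollectI ballI)
    fix a assume "a \<in> E"
    then obtain y where "y \<in> R" "has_value f a y"
      using \<open>f \<in> int_rat E R\<close> unfolding int_rat_def by blast
    then show "\<exists>z\<in>R. has_value (- f) a z" by (intro bexI[of _ "- y"] has_value_minus minus)
  qed
  have int_rat_mult: "f * g \<in> int_rat E R" and int_rat_add: "f + g \<in> int_rat E R"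
    if f: "f \<in> int_rat E R" and g: "g \<in> int_rat E R" for f g
  proof -
    have *: "\<exists>y\<in>R. \<exists>z\<in>R. has_value f a y \<and> has_value g a z" if "a \<in> E" for a
      using f g that unfolding int_rat_def by blast
    show "f * g \<in> int_rat E R" unfolding int_rat_def
    proof (intro CollectI ballI)
      fix a assume "a \<in> E"
      then obtain y z where "y \<in> R" "z \<in> R" "has_value f a y" "has_value g a z"
        using * by blast
      then show "\<exists>x\<in>R. has_value (f * g) a x" by (intro bexI[of _ "y * z"] has_value_mult mult)
    qed
    show "f + g \<in> int_rat E R" unfolding int_rat_def
    proof (intro CollectI ballI)
      fix a assume "a \<in> E"
      then obtain y z where "y \<in> R" "z \<in> R" "has_value f a y" "has_value g a z"
        using * by blast
      then show "\<exists>x\<in>R. has_value (f + g) a x" by (intro bexI[of _ "y + z"] has_value_add add)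
    qed
  qed
  have "has_value 1 a (1 :: 'k)" for a
    using has_value_const[of 1 a] by (simp add: One_fract_def one_pCons)
  then have int_rat_one: "1 \<in> int_rat E R"
    unfolding int_rat_def using one by blast
  show ?thesis
  proof (rule L.subringI)
    show "int_rat E R \<subseteq> carrier ?L" by (simp add: ring_of_type_algebra_def)
    show "\<one>\<^bsub>?L\<^esub> \<in> int_rat E R" using int_rat_one by (simp add: ring_of_type_algebra_def)
    show "\<ominus>\<^bsub>?L\<^esub> f \<in> int_rat E R" if "f \<in> int_rat E R" for f
      using int_rat_minus[OF that] by (simp only: uminus_L)
    show "f \<otimes>\<^bsub>?L\<^esub> g \<in> int_rat E R" if "f \<in> int_rat E R" "g \<in> int_rat E R" for f g
      using int_rat_mult[OF that] by (simp add: ring_of_type_algebra_def)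
    show "f \<oplus>\<^bsub>?L\<^esub> g \<in> int_rat E R" if "f \<in> int_rat E R" "g \<in> int_rat E R" for f g
      using int_rat_add[OF that] by (simp add: ring_of_type_algebra_def)
  qed
qed

end

theory Submission
  imports Defs "HOL-Computational_Algebra.Normalized_Fraction"
begin

text \<open>
  \<open>Int\<^sup>R(E,D)\<close> and \<open>Int\<^sup>R(E,B)\<close> share the ideal \<open>J = Int\<^sup>R(E,I)\<close>. Primes of the smaller ring not
  containing \<open>J\<close> lift to the larger one, and since \<open>D/I\<close> is finite, primes containing \<open>J\<close> are maximal;
  hence only the top of a chain can fail to lift, and there comaximality with \<open>J\<close> supplies a
  replacement.

  For the upper bound, a chain of primes of a subring of \<open>K(X)\<close> containing \<open>B\<close> is the trace of a chain of
  primes of a valuation ring \<open>W\<close> of \<open>K(X)\<close>. As \<open>K(X)\<close> has transcendence degree one over \<open>K\<close>, contracting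
  the chain to the valuation overring \<open>W \<inter> K\<close> of \<open>B\<close> identifies at most one pair of neighbours. For the
  lower bound, primes of \<open>D\<close> are pulled back along evaluation at a point of \<open>E\<close>, and the zero ideal is
  put below them.
\<close>

section \<open>Subrings, ideals and primes as sets\<close>

text \<open>Plain-set versions of the HOL-Algebra notions, so that arithmetic is that of the ambient
  type; \<open>subring_set_iff_subdomain\<close>, \<open>ideal_set_iff\<close> and
  \<open>prime_set_iff\<close> give the translation.\<close>

definition subring_set :: "'a::comm_ring_1 set \<Rightarrow> bool" where
  "subring_set S \<longleftrightarrow> 1 \<in> S \<and> (\<forall>x\<in>S. \<forall>y\<in>S. x - y \<in> S \<and> x * y \<in> S)"

definition ideal_set :: "'a::comm_ring_1 set \<Rightarrow> 'a set \<Rightarrow> bool" where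
  "ideal_set J S \<longleftrightarrow> J \<subseteq> S \<and> 0 \<in> J \<and> (\<forall>x\<in>J. \<forall>y\<in>J. x + y \<in> J) \<and> (\<forall>s\<in>S. \<forall>x\<in>J. s * x \<in> J)"

definition prime_set :: "'a::comm_ring_1 set \<Rightarrow> 'a set \<Rightarrow> bool" where
  "prime_set P S \<longleftrightarrow> ideal_set P S \<and> 1 \<notin> P \<and> (\<forall>x\<in>S. \<forall>y\<in>S. x * y \<in> P \<longrightarrow> x \<in> P \<or> y \<in> P)"

lemma subring_set_1: "subring_set S \<Longrightarrow> 1 \<in> S"
  and subring_set_diff: "subring_set S \<Longrightarrow> x \<in> S \<Longrightarrow> y \<in> S \<Longrightarrow> x - y \<in> S"
  and subring_set_mult: "subring_set S \<Longrightarrow> x \<in> S \<Longrightarrow> y \<in> S \<Longrightarrow> x * y \<in> S"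
  by (auto simp: subring_set_def)

lemma subring_set_0: "subring_set S \<Longrightarrow> 0 \<in> S"
  using subring_set_diff[of S 1 1] subring_set_1 by auto

lemma subring_set_uminus: "subring_set S \<Longrightarrow> x \<in> S \<Longrightarrow> - x \<in> S"
  using subring_set_diff[of S 0 x] subring_set_0 by auto

lemma subring_set_add: "subring_set S \<Longrightarrow> x \<in> S \<Longrightarrow> y \<in> S \<Longrightarrow> x + y \<in> S"
  using subring_set_diff[of S x "- y"] subring_set_uminus by auto

lemma subring_set_sum: "subring_set S \<Longrightarrow> (\<And>i. i \<in> A \<Longrightarrow> f i \<in> S) \<Longrightarrow> sum f A \<in> S"
  by (induction A rule: infinite_finite_induct) (auto intro: subring_set_0 subring_set_add)

lemma subring_set_power: "subring_set S \<Longrightarrow> x \<in> S \<Longrightarrow> x ^ n \<in> S"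
  by (induction n) (auto intro: subring_set_1 subring_set_mult)

lemma subring_set_prod: "subring_set S \<Longrightarrow> (\<And>i. i \<in> A \<Longrightarrow> f i \<in> S) \<Longrightarrow> prod f A \<in> S"
  by (induction A rule: infinite_finite_induct) (auto intro: subring_set_1 subring_set_mult)

lemmas subring_set_closed = subring_set_0 subring_set_1 subring_set_add subring_set_diff
  subring_set_uminus subring_set_mult subring_set_sum subring_set_power subring_set_prod

lemma ideal_set_subset: "ideal_set J S \<Longrightarrow> x \<in> J \<Longrightarrow> x \<in> S"
  and ideal_set_0: "ideal_set J S \<Longrightarrow> 0 \<in> J"
  and ideal_set_add: "ideal_set J S \<Longrightarrow> x \<in> J \<Longrightarrow> y \<in> J \<Longrightarrow> x + y \<in> J"
  and ideal_set_mult: "ideal_set J S \<Longrightarrow> s \<in> S \<Longrightarrow> x \<in> J \<Longrightarrow> s * x \<in> J"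
  by (auto simp: ideal_set_def)

lemma ideal_set_mult': "ideal_set J S \<Longrightarrow> s \<in> S \<Longrightarrow> x \<in> J \<Longrightarrow> x * s \<in> J"
  by (metis ideal_set_mult mult.commute)

lemma ideal_set_uminus: "subring_set S \<Longrightarrow> ideal_set J S \<Longrightarrow> x \<in> J \<Longrightarrow> - x \<in> J"
  using ideal_set_mult[of J S "-1" x] by (auto intro: subring_set_closed)

lemma ideal_set_diff: "subring_set S \<Longrightarrow> ideal_set J S \<Longrightarrow> x \<in> J \<Longrightarrow> y \<in> J \<Longrightarrow> x - y \<in> J"
  using ideal_set_add[of J S x "- y"] ideal_set_uminus[of S J y] by auto

lemma ideal_set_sum: "ideal_set J S \<Longrightarrow> (\<And>i. i \<in> A \<Longrightarrow> f i \<in> J) \<Longrightarrow> sum f A \<in> J"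
  by (induction A rule: infinite_finite_induct) (auto intro: ideal_set_0 ideal_set_add)

lemma ideal_set_prod:
  assumes "subring_set S" "ideal_set J S" "finite A" "i \<in> A" "f i \<in> J" "\<And>k. k \<in> A \<Longrightarrow> f k \<in> S"
  shows "prod f A \<in> J"
proof -
  have "prod f A = prod f (A - {i}) * f i"
    using assms(3,4) by (simp add: prod.remove mult.commute)
  then show ?thesis
    using ideal_set_mult[OF assms(2) subring_set_prod[OF assms(1)] assms(5), of "A - {i}" f] assms(6)
    by auto
qed

lemma prime_set_ideal: "prime_set P S \<Longrightarrow> ideal_set P S"
  and prime_set_1: "prime_set P S \<Longrightarrow> 1 \<notin> P"
  and prime_set_mult: "prime_set P S \<Longrightarrow> x \<in> S \<Longrightarrow> y \<in> S \<Longrightarrow> x * y \<in> P \<Longrightarrow> x \<in> P \<or> y \<in> P"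
  by (auto simp: prime_set_def)

lemma prime_set_prod:
  assumes "subring_set S" "prime_set P S" "finite A" "\<And>k. k \<in> A \<Longrightarrow> f k \<in> S" "prod f A \<in> P"
  shows "\<exists>k\<in>A. f k \<in> P"
  using assms(3-)
proof (induction A rule: finite_induct)
  case empty
  then show ?case using assms(2) by (simp add: prime_set_1)
next
  case (insert a A)
  then have "f a \<in> P \<or> prod f A \<in> P"
    by (intro prime_set_mult[OF assms(2)]) (auto intro: subring_set_closed assms(1))
  then show ?case using insert by auto
qed

section \<open>Translation to the HOL-Algebra notions\<close>

lemma ring_of_type_algebra_simps [simp]:
  "x \<oplus>\<^bsub>ring_of_type_algebra\<^esub> y = x + y" "x \<otimes>\<^bsub>ring_of_type_algebra\<^esub> y = x * y"
  "\<zero>\<^bsub>ring_of_type_algebra\<^esub> = 0" "\<one>\<^bsub>ring_of_type_algebra\<^esub> = 1"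
  by (auto simp: ring_of_type_algebra_def)

lemma subring_set_of_subring:
  assumes "subring S (ring_of_type_algebra :: 'a::comm_ring_1 ring)"
  shows "subring_set S"
proof -
  interpret K: ring "ring_of_type_algebra :: 'a ring" by (rule ring_from_type_algebra)
  have "\<ominus>\<^bsub>ring_of_type_algebra\<^esub> x = - x" for x :: 'a
    by (rule K.minus_equality) (simp_all add: ring_of_type_algebra_def)
  then have "- x \<in> S" if "x \<in> S" for x
    using subringE(5)[OF assms that] by simp
  then have "x - y \<in> S" if "x \<in> S" "y \<in> S" for x y
    using subringE(7)[OF assms, of x "- y"] that by simp
  then show ?thesis
    using subringE(3,6)[OF assms] by (auto simp: subring_set_def ring_of_type_algebra_def)
qed

lemma subring_set_of_subdomain:
  "subdomain S (ring_of_type_algebra :: 'a::comm_ring_1 ring) \<Longrightarrow> subring_set S"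
  by (intro subring_set_of_subring) (simp add: subdomain_def subcring_def)

lemma subring_set_iff_subdomain:
  fixes S :: "'a::field set"
  shows "subdomain S ring_of_type_algebra \<longleftrightarrow> subring_set S"
proof
  assume S: "subring_set S"
  interpret K: ring "ring_of_type_algebra :: 'a ring" by (rule ring_from_type_algebra)
  have "\<ominus>\<^bsub>ring_of_type_algebra\<^esub> x = - x" for x :: 'a
    by (rule K.minus_equality) (simp_all add: ring_of_type_algebra_def)
  then have "subring S ring_of_type_algebra"
    using S by (intro K.subringI) (auto simp: ring_of_type_algebra_def intro: subring_set_closed)
  then show "subdomain S ring_of_type_algebra"
    by (auto simp: subdomain_def subcring_def subcring_axioms_def subdomain_axioms_def
        ring_of_type_algebra_def mult.commute)
qed (rule subring_set_of_subdomain)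

lemma cring_ring_on:
  assumes "subring_set S"
  shows "cring (ring_on S)"
proof -
  have "\<exists>y\<in>S. y + x = 0 \<and> x + y = 0" if "x \<in> S" for x
    using that assms by (intro bexI[of _ "- x"]) (auto intro: subring_set_closed)
  then show ?thesis
    using assms
    by unfold_locales
      (auto simp: ring_of_type_algebra_def Units_def algebra_simps intro: subring_set_closed)
qed

lemma ideal_set_iff:
  assumes "subring_set S"
  shows "ideal J (ring_on S) \<longleftrightarrow> ideal_set J S"
proof
  assume "ideal J (ring_on S)"
  then interpret ideal J "ring_on S" .
  show "ideal_set J S"
    using a_subset additive_subgroup.zero_closed[OF is_additive_subgroup]
      additive_subgroup.a_closed[OF is_additive_subgroup] I_l_closed
    by (auto simp: ideal_set_def)
next
  assume J: "ideal_set J S"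
  interpret cring "ring_on S" by (rule cring_ring_on) fact
  have minus: "\<ominus>\<^bsub>ring_on S\<^esub> x = - x" if "x \<in> S" for x
    by (rule minus_equality) (use that assms in \<open>auto intro: subring_set_closed\<close>)
  show "ideal J (ring_on S)"
  proof (rule idealI[OF ring_axioms add.subgroupI])
    show "\<ominus>\<^bsub>ring_on S\<^esub> x \<in> J" if "x \<in> J" for x
      using minus[of x] that ideal_set_uminus[OF assms J that] ideal_set_subset[OF J]
      by simp
  qed (use ideal_set_subset[OF J] ideal_set_0[OF J] ideal_set_add[OF J] ideal_set_mult[OF J]
      ideal_set_mult'[OF J] in auto)
qed

lemma prime_set_iff:
  assumes "subring_set S"
  shows "primeideal P (ring_on S) \<longleftrightarrow> prime_set P S"
proof
  assume "primeideal P (ring_on S)"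
  then interpret primeideal P "ring_on S" .
  have P: "ideal_set P S" using ideal_axioms ideal_set_iff[OF assms] by simp
  have "1 \<notin> P"
  proof
    assume "1 \<in> P"
    then have "S \<subseteq> P" using ideal_set_mult[OF P, of _ 1] by auto
    then show False using I_notcarr ideal_set_subset[OF P] by auto
  qed
  then show "prime_set P S" using P I_prime by (auto simp: prime_set_def)
next
  assume P: "prime_set P S"
  show "primeideal P (ring_on S)"
    using P assms by (intro primeidealI cring_ring_on)
      (auto simp: ideal_set_iff prime_set_def intro: subring_set_1)
qed

lemma le_krull_dim:
  assumes "subring_set S" "\<And>i. i \<le> n \<Longrightarrow> prime_set (P i) S" "\<And>i. i < n \<Longrightarrow> P i \<subset> P (Suc i)"
  shows "enat n \<le> krull_dim (ring_on S)"
  unfolding krull_dim_def by (rule Sup_upper) (use assms in \<open>auto simp: prime_set_iff\<close>)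

lemma krull_dim_le:
  assumes "subring_set S"
    and "\<And>n P. (\<And>i. i \<le> n \<Longrightarrow> prime_set (P i) S) \<Longrightarrow> (\<And>i. i < n \<Longrightarrow> P i \<subset> P (Suc i)) \<Longrightarrow> enat n \<le> k"
  shows "krull_dim (ring_on S) \<le> k"
  unfolding krull_dim_def by (rule Sup_least) (use assms in \<open>auto simp: prime_set_iff\<close>)

section \<open>Valuation rings\<close>

text \<open>These are the valuation rings whose quotient field is the whole ambient type.\<close>

definition val_ring :: "'a::field set \<Rightarrow> bool" where
  "val_ring W \<longleftrightarrow> subring_set W \<and> (\<forall>x. x \<in> W \<or> inverse x \<in> W)"

text \<open>The maximal ideal, when \<open>W\<close> is a valuation ring. Zero is listed separately
  because \<open>inverse 0 = 0\<close> lies in \<open>W\<close>.\<close>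

definition nonunits :: "'a::field set \<Rightarrow> 'a set" where
  "nonunits W = {x \<in> W. x = 0 \<or> inverse x \<notin> W}"

lemma val_ring_subring: "val_ring W \<Longrightarrow> subring_set W"
  and val_ring_total: "val_ring W \<Longrightarrow> x \<in> W \<or> inverse x \<in> W"
  by (auto simp: val_ring_def)

lemma nonunits_mult:
  assumes "subring_set W" "s \<in> W" "x \<in> nonunits W"
  shows "s * x \<in> nonunits W"
proof (cases "s * x = 0")
  case False
  have "s * inverse (s * x) = inverse x" using False by (simp add: field_simps)
  then have "inverse (s * x) \<notin> W"
    using assms False subring_set_mult[OF assms(1,2), of "inverse (s * x)"]
    unfolding nonunits_def by (metis (lifting) mem_Collect_eq mult_eq_0_iff)
  then show ?thesis
    using assms subring_set_mult[OF assms(1,2), of x] by (simp add: nonunits_def)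
qed (use assms in \<open>auto simp: nonunits_def subring_set_0\<close>)

text \<open>One of \<open>x / y\<close> and \<open>y / x\<close> lies in \<open>W\<close>, so for
  nonzero \<open>x\<close> and \<open>y\<close> the sum is a multiple, by an element of
  \<open>W\<close>, of one of the two.\<close>

lemma nonunits_add:
  assumes W: "val_ring W" and xy: "x \<in> nonunits W" "y \<in> nonunits W"
  shows "x + y \<in> nonunits W"
proof -
  have main: "a + b \<in> nonunits W"
    if "a / b \<in> W" "b \<noteq> 0" "b \<in> nonunits W" for a b
  proof -
    have "a + b = (a / b + 1) * b" using that by (simp add: field_simps)
    then show ?thesis
      using nonunits_mult[OF val_ring_subring[OF W] _ that(3), of "a / b + 1"] that W
      by (metis subring_set_1 subring_set_add val_ring_subring)
  qed
  have "x / y \<in> W \<or> y / x \<in> W" using val_ring_total[OF W, of "x / y"] by (simp add: field_simps)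
  then show ?thesis
    using xy main[of x y] main[of y x] by (cases "x = 0"; cases "y = 0") (auto simp: add.commute)
qed

lemma prime_set_nonunits:
  assumes "val_ring W"
  shows "prime_set (nonunits W) W"
  unfolding prime_set_def ideal_set_def
proof (intro conjI ballI impI)
  note W = val_ring_subring[OF assms]
  show "nonunits W \<subseteq> W" "0 \<in> nonunits W" "1 \<notin> nonunits W"
    using W by (auto simp: nonunits_def subring_set_closed)
  show "x + y \<in> nonunits W" if "x \<in> nonunits W" "y \<in> nonunits W" for x y
    using nonunits_add[OF assms that] .
  show "s * x \<in> nonunits W" if "s \<in> W" "x \<in> nonunits W" for s x
    using nonunits_mult[OF W that] .
  show "x \<in> nonunits W \<or> y \<in> nonunits W" if "x \<in> W" "y \<in> W" "x * y \<in> nonunits W" for x y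
    using that subring_set_mult[OF W, of "inverse x" "inverse y"] by (auto simp: nonunits_def)
qed

lemma nonunits_mono:
  assumes "val_ring W" "val_ring W'" "W' \<subseteq> W"
  shows "nonunits W \<subseteq> nonunits W'"
  using assms val_ring_total[OF assms(2)] subring_set_0[OF val_ring_subring[OF assms(2)]]
  by (auto simp: nonunits_def)

text \<open>Converse to \<open>nonunits_mono\<close>: an element of \<open>W'\<close> outside
  \<open>W\<close> would have its inverse in \<open>nonunits W\<close>, hence in
  \<open>nonunits W'\<close>, which its own membership in \<open>W'\<close> forbids.\<close>

lemma val_ring_subset_if_nonunits:
  assumes "val_ring W" "subring_set W'" "nonunits W \<subseteq> nonunits W'"
  shows "W' \<subseteq> W"
proof
  fix x assume x: "x \<in> W'"
  show "x \<in> W"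
  proof (rule ccontr)
    assume "x \<notin> W"
    then have "inverse x \<in> W" "x \<noteq> 0" using val_ring_total[OF assms(1), of x] subring_set_0 assms(1)
      by (auto simp: val_ring_def)
    then have "inverse x \<in> nonunits W" using \<open>x \<notin> W\<close> by (simp add: nonunits_def)
    then show False using assms(3) x \<open>x \<noteq> 0\<close> by (auto simp: nonunits_def)
  qed
qed

section \<open>Existence of valuation rings centred on a given ideal\<close>

text \<open>This is \<open>S[x]\<close>; applied to an ideal \<open>J\<close> of \<open>S\<close> it
  is the extension of \<open>J\<close> to \<open>S[x]\<close>.\<close>

definition poly_ext :: "'a::comm_ring_1 set \<Rightarrow> 'a \<Rightarrow> 'a set" where
  "poly_ext S x = {poly p x | p. \<forall>i. coeff p i \<in> S}"

lemma poly_ext_base: "0 \<in> S \<Longrightarrow> s \<in> S \<Longrightarrow> s \<in> poly_ext S x"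
  unfolding poly_ext_def by (auto intro!: exI[of _ "[:s:]"] simp: coeff_pCons split: nat.split)

lemma poly_ext_gen: "subring_set S \<Longrightarrow> x \<in> poly_ext S x"
  unfolding poly_ext_def
  by (auto intro!: exI[of _ "[:0, 1:]"] simp: coeff_pCons subring_set_closed split: nat.split)

lemma subring_set_poly_ext:
  assumes S: "subring_set S"
  shows "subring_set (poly_ext S x)"
  unfolding subring_set_def
proof (intro conjI ballI)
  show "1 \<in> poly_ext S x" using S by (intro poly_ext_base) (auto intro: subring_set_closed)
  fix a b assume "a \<in> poly_ext S x" "b \<in> poly_ext S x"
  then obtain p q where p: "a = poly p x" "\<And>i. coeff p i \<in> S" and q: "b = poly q x" "\<And>i. coeff q i \<in> S"
    by (auto simp: poly_ext_def)
  show "a - b \<in> poly_ext S x"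
    unfolding poly_ext_def using p q S by (auto intro!: exI[of _ "p - q"] subring_set_closed)
  show "a * b \<in> poly_ext S x"
    unfolding poly_ext_def using p q S
    by (auto intro!: exI[of _ "p * q"] subring_set_closed simp: coeff_mult)
qed

lemma ideal_set_poly_ext:
  assumes S: "subring_set S" and J: "ideal_set J S"
  shows "ideal_set (poly_ext J x) (poly_ext S x)"
  unfolding ideal_set_def
proof (intro conjI ballI)
  show "poly_ext J x \<subseteq> poly_ext S x" using ideal_set_subset[OF J] by (auto simp: poly_ext_def)
  show "0 \<in> poly_ext J x" using J by (intro poly_ext_base) (auto intro: ideal_set_0)
  show "a + b \<in> poly_ext J x" if ab: "a \<in> poly_ext J x" "b \<in> poly_ext J x" for a b
  proof -
    obtain p q where p: "a = poly p x" "\<And>i. coeff p i \<in> J" and q: "b = poly q x" "\<And>i. coeff q i \<in> J"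
      using ab by (auto simp: poly_ext_def)
    then show ?thesis
      unfolding poly_ext_def using J by (auto intro!: exI[of _ "p + q"] ideal_set_add)
  qed
  show "a * b \<in> poly_ext J x" if ab: "a \<in> poly_ext S x" "b \<in> poly_ext J x" for a b
  proof -
    obtain p q where p: "a = poly p x" "\<And>i. coeff p i \<in> S" and q: "b = poly q x" "\<And>i. coeff q i \<in> J"
      using ab by (auto simp: poly_ext_def)
    then show ?thesis
      unfolding poly_ext_def using J
      by (auto intro!: exI[of _ "p * q"] ideal_set_mult ideal_set_sum simp: coeff_mult)
  qed
qed

text \<open>The descent step behind the existence of valuation rings, with a multiplicative set
  \<open>T\<close> in place of the single element 1. The polynomial of larger degree is shortened
  with the help of the other one, until one of them is constant; its value is then in both
  \<open>J\<close> and \<open>T\<close>.\<close>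

lemma poly_inverse_disjoint:
  fixes x :: "'a::field"
  assumes S: "subring_set S" and J: "ideal_set J S"
    and T: "T \<subseteq> S" "\<And>s t. s \<in> T \<Longrightarrow> t \<in> T \<Longrightarrow> s * t \<in> T" "J \<inter> T = {}"
    and "x \<noteq> 0" "\<And>i. coeff p i \<in> J" "\<And>i. coeff q i \<in> J" "poly p x \<in> T" "poly q (inverse x) \<in> T"
  shows False
  using assms(6-)
proof (induction "degree p + degree q" arbitrary: x p q rule: less_induct)
  case less
  show False
  proof (cases "degree p = 0 \<or> degree q = 0")
    case True
    then have "poly p x \<in> J \<or> poly q (inverse x) \<in> J"
      using less(3)[of 0] less(4)[of 0] by (auto elim!: degree_eq_zeroE)
    then show False using less(5,6) T(3) by blast
  next
    case False
    have reduce: "\<exists>r. degree r < degree p \<and> (\<forall>i. coeff r i \<in> J) \<and> poly r x \<in> T"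
      if le: "degree q \<le> degree p" "degree p \<noteq> 0" and x: "x \<noteq> 0"
        and p: "\<And>i. coeff p i \<in> J" and q: "\<And>i. coeff q i \<in> J"
        and t: "poly p x \<in> T" and t': "poly q (inverse x) \<in> T" for x :: 'a and p q
    proof -
      \<comment> \<open>Multiply \<open>t\<close> by \<open>t' - b\<^sub>0\<close> and cancel its leading term \<open>a x\<^sup>n\<close> with
        \<open>x\<^sup>n (t' - b\<^sub>0)\<close>, which is a polynomial in \<open>x\<close> of degree less than \<open>n\<close>.\<close>
      define n where "n = degree p"
      define a where "a = coeff p n"
      define p0 where "p0 = p - monom a n"
      define u where "u = (\<Sum>j\<in>{1..degree q}. monom (coeff q j) (n - j))"
      define t t' b where "t = poly p x" and "t' = poly q (inverse x)" and "b = coeff q 0"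
      define r where "r = [:b * t:] + smult (t' - b) p0 + smult a u"
      have "coeff p0 i = 0" if "i > n - 1" for i
        using that unfolding p0_def a_def n_def by (cases "i = degree p") (auto simp: coeff_eq_0)
      then have "degree p0 \<le> n - 1" by (intro degree_le) auto
      moreover have "degree u \<le> n - 1"
        unfolding u_def by (intro degree_sum_le) (auto intro!: order.trans[OF degree_monom_le])
      ultimately have "degree r \<le> n - 1"
        unfolding r_def by (auto intro!: degree_add_le order.trans[OF degree_smult_le])
      moreover have "coeff r i \<in> J" for i
      proof -
        have "coeff p0 i \<in> J"
          unfolding p0_def a_def using p J by (auto intro: ideal_set_0)
        moreover have "t' - b \<in> S" "a \<in> S"
          unfolding t'_def b_def a_def using T t' p q J S
          by (auto intro!: subring_set_diff intro: ideal_set_subset)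
        moreover have "coeff u i \<in> J"
          unfolding u_def coeff_sum using q J by (auto intro!: ideal_set_sum intro: ideal_set_0)
        moreover have "b * t \<in> J"
          unfolding b_def t_def using q t T by (auto intro!: ideal_set_mult'[OF J])
        ultimately show ?thesis
          unfolding r_def using J
          by (auto intro!: ideal_set_add[OF J] ideal_set_mult[OF J] intro: ideal_set_0
              simp: coeff_pCons split: nat.split)
      qed
      moreover have "poly r x \<in> T"
      proof -
        have "t' = (\<Sum>j\<in>{0..degree q}. coeff q j * inverse x ^ j)"
          unfolding t'_def by (simp add: poly_altdef atMost_atLeast0)
        also have "\<dots> = b + (\<Sum>j\<in>{1..degree q}. coeff q j * inverse x ^ j)"
          unfolding b_def by (simp add: sum.atLeast_Suc_atMost)
        finally have "x ^ n * (t' - b) = (\<Sum>j\<in>{1..degree q}. x ^ n * (coeff q j * inverse x ^ j))"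
          by (simp add: sum_distrib_left)
        also have "\<dots> = poly u x"
          unfolding u_def poly_sum using le x
          by (intro sum.cong) (auto simp: poly_monom power_diff n_def field_simps)
        finally have u: "poly u x = x ^ n * (t' - b)" ..
        have "poly p0 x = t - a * x ^ n" unfolding p0_def t_def by (simp add: poly_monom)
        then have "poly r x = b * t + (t' - b) * (t - a * x ^ n) + a * (x ^ n * (t' - b))"
          unfolding r_def by (simp only: poly_add poly_smult u) simp
        also have "\<dots> = t' * t" by (simp add: algebra_simps)
        finally have "poly r x = t' * t" .
        then show ?thesis using T(2) t t' t_def t'_def by simp
      qed
      ultimately show ?thesis using le(2) unfolding n_def by (intro exI[of _ r]) auto
    qed
    show False
    proof (cases "degree q \<le> degree p")
      case True
      then obtain r where "degree r < degree p" "\<forall>i. coeff r i \<in> J" "poly r x \<in> T"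
        using reduce[OF True _ less(2-6)] False by (metis (no_types))
      then show False using less(1)[of r q x] less by auto
    next
      case le: False
      then obtain r where "degree r < degree q" "\<forall>i. coeff r i \<in> J" "poly r (inverse x) \<in> T"
        using reduce[of p q "inverse x"] False less(2-6) by fastforce
      then show False using less(1)[of p r x] less by auto
    qed
  qed
qed

text \<open>Take a maximal pair of a ring \<open>S\<close> above \<open>R\<close> and an ideal
  \<open>J\<close> of \<open>S\<close> above \<open>J0\<close> that avoids \<open>T\<close>. For
  \<open>x\<close> outside \<open>S\<close>, maximality forces the extension of \<open>J\<close> to
  \<open>S[x]\<close> to meet \<open>T\<close>; by \<open>poly_inverse_disjoint\<close> this cannot
  happen for \<open>x\<close> and \<open>inverse x\<close> at once. The choice
  \<open>T = {1}\<close> gives a valuation ring whose maximal ideal contains \<open>J0\<close>, and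
  \<open>T = R - P\<close> makes that ideal contract into a given prime \<open>P\<close>.\<close>

lemma exists_val_ring:
  fixes R :: "'a::field set"
  assumes R: "subring_set R" and J0: "ideal_set J0 R"
    and T: "T \<subseteq> R" "1 \<in> T" "\<And>s t. s \<in> T \<Longrightarrow> t \<in> T \<Longrightarrow> s * t \<in> T" "J0 \<inter> T = {}"
  shows "\<exists>W. val_ring W \<and> R \<subseteq> W \<and> J0 \<subseteq> nonunits W \<and> nonunits W \<inter> T = {}"
proof -
  \<comment> \<open>Zorn's lemma on pairs \<open>(S, J)\<close>, encoded as the disjoint union \<open>S <+> J\<close>.\<close>
  define good where "good = (\<lambda>S J. subring_set S \<and> ideal_set J S \<and> R \<subseteq> S \<and> J0 \<subseteq> J \<and> J \<inter> T = {})"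
  define A where "A = {Z. good (Inl -` Z) (Inr -` Z)}"
  have "\<exists>M\<in>A. \<forall>Z\<in>A. M \<subseteq> Z \<longrightarrow> Z = M"
  proof (rule subset_Zorn_nonempty)
    have "Inl -` (R <+> J0) = R" "Inr -` (R <+> J0) = J0" by auto
    then have "R <+> J0 \<in> A" using R J0 T(4) by (simp add: A_def good_def)
    then show "A \<noteq> {}" by blast
    fix C assume ne: "C \<noteq> {}" and chain: "subset.chain A C"
    have good: "good (Inl -` Z) (Inr -` Z)" if "Z \<in> C" for Z
      using chain that by (auto simp: subset.chain_def A_def)
    then have C: "subring_set (Inl -` Z)" "ideal_set (Inr -` Z) (Inl -` Z)" if "Z \<in> C" for Z
      using that by (simp_all add: good_def)
    obtain Z0 where Z0: "Z0 \<in> C" using ne by blast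
    have dir: "\<exists>Z\<in>C. U \<subseteq> Z \<and> V \<subseteq> Z" if "U \<in> C" "V \<in> C" for U V
      using chain that unfolding subset_chain_def by (metis order.refl)
    have "subring_set (\<Union>Z\<in>C. Inl -` Z)"
      unfolding subring_set_def
    proof (intro conjI ballI)
      show "1 \<in> (\<Union>Z\<in>C. Inl -` Z)" using Z0 subring_set_1[OF C(1)[OF Z0]] by (rule UN_I)
      fix x y assume "x \<in> (\<Union>Z\<in>C. Inl -` Z)" "y \<in> (\<Union>Z\<in>C. Inl -` Z)"
      then obtain Z where Z: "Z \<in> C" and "x \<in> Inl -` Z" "y \<in> Inl -` Z" using dir by blast
      then have "x - y \<in> Inl -` Z" "x * y \<in> Inl -` Z"
        using subring_set_diff[OF C(1)] subring_set_mult[OF C(1)] by blast+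
      then show "x - y \<in> (\<Union>Z\<in>C. Inl -` Z)" "x * y \<in> (\<Union>Z\<in>C. Inl -` Z)"
        using Z by (blast intro: UN_I)+
    qed
    moreover have "ideal_set (\<Union>Z\<in>C. Inr -` Z) (\<Union>Z\<in>C. Inl -` Z)"
      unfolding ideal_set_def
    proof (intro conjI ballI)
      show "(\<Union>Z\<in>C. Inr -` Z) \<subseteq> (\<Union>Z\<in>C. Inl -` Z)"
        using ideal_set_subset[OF C(2)] by blast
      show "0 \<in> (\<Union>Z\<in>C. Inr -` Z)" using Z0 ideal_set_0[OF C(2)[OF Z0]] by (rule UN_I)
      show "x + y \<in> (\<Union>Z\<in>C. Inr -` Z)"
        if x: "x \<in> (\<Union>Z\<in>C. Inr -` Z)" and y: "y \<in> (\<Union>Z\<in>C. Inr -` Z)" for x y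
      proof -
        obtain Z where Z: "Z \<in> C" and "x \<in> Inr -` Z" "y \<in> Inr -` Z" using dir x y by blast
        then have "x + y \<in> Inr -` Z" using ideal_set_add[OF C(2)] by blast
        then show ?thesis using Z by (blast intro: UN_I)
      qed
      show "x * y \<in> (\<Union>Z\<in>C. Inr -` Z)"
        if x: "x \<in> (\<Union>Z\<in>C. Inl -` Z)" and y: "y \<in> (\<Union>Z\<in>C. Inr -` Z)" for x y
      proof -
        obtain Z where Z: "Z \<in> C" and "x \<in> Inl -` Z" "y \<in> Inr -` Z" using dir x y by blast
        then have "x * y \<in> Inr -` Z" using ideal_set_mult[OF C(2)] by blast
        then show ?thesis using Z by (blast intro: UN_I)
      qed
    qed
    moreover have "R \<subseteq> (\<Union>Z\<in>C. Inl -` Z)" "J0 \<subseteq> (\<Union>Z\<in>C. Inr -` Z)"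
      using good[OF Z0] Z0 unfolding good_def by blast+
    moreover have "(\<Union>Z\<in>C. Inr -` Z) \<inter> T = {}"
    proof -
      have "Inr -` Z \<inter> T = {}" if "Z \<in> C" for Z using good[OF that] by (simp add: good_def)
      then show ?thesis by blast
    qed
    ultimately show "\<Union>C \<in> A" unfolding A_def good_def by (simp add: vimage_Union)
  qed
  then obtain M where M: "M \<in> A" "\<And>Z. Z \<in> A \<Longrightarrow> M \<subseteq> Z \<Longrightarrow> Z = M" by blast
  define S J where "S = Inl -` M" and "J = Inr -` M"
  have SJ: "good S J" using M(1) by (simp add: A_def S_def J_def)
  then have S: "subring_set S" and J: "ideal_set J S" and RS: "R \<subseteq> S" and J0J: "J0 \<subseteq> J"
    and disj: "J \<inter> T = {}" by (auto simp: good_def)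
  have max: "\<exists>p. (\<forall>i. coeff p i \<in> J) \<and> poly p x \<in> T" if "x \<notin> S" for x
  proof (rule ccontr)
    assume *: "\<nexists>p. (\<forall>i. coeff p i \<in> J) \<and> poly p x \<in> T"
    have "S \<subseteq> poly_ext S x" "J \<subseteq> poly_ext J x"
      using S J by (auto intro: poly_ext_base subring_set_0 ideal_set_0)
    moreover from this have "good (poly_ext S x) (poly_ext J x)"
      using * S J RS J0J unfolding good_def
      by (auto intro!: subring_set_poly_ext ideal_set_poly_ext) (auto simp: poly_ext_def)
    moreover have "Inl -` (poly_ext S x <+> poly_ext J x) = poly_ext S x"
      "Inr -` (poly_ext S x <+> poly_ext J x) = poly_ext J x" by auto
    ultimately have A: "poly_ext S x <+> poly_ext J x \<in> A"
      and "M \<subseteq> poly_ext S x <+> poly_ext J x"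
      unfolding A_def S_def J_def
       apply simp
      apply (rule subsetI)
      subgoal for m using \<open>S \<subseteq> _\<close> \<open>J \<subseteq> _\<close> unfolding S_def J_def by (cases m) auto
      done
    then have "poly_ext S x <+> poly_ext J x = M" using M(2) by blast
    then have "poly_ext S x = S" unfolding S_def by auto
    then show False using poly_ext_gen[OF S, of x] that by simp
  qed
  have W: "val_ring S"
    unfolding val_ring_def
  proof (intro conjI allI S)
    fix x
    show "x \<in> S \<or> inverse x \<in> S"
    proof (rule ccontr)
      assume "\<not> (x \<in> S \<or> inverse x \<in> S)"
      moreover from this have "x \<noteq> 0" using subring_set_0[OF S] by auto
      ultimately show False
        using max[of x] max[of "inverse x"] poly_inverse_disjoint[OF S J _ T(3) disj] T(1) RS by blast
    qed
  qed
  \<comment> \<open>If \<open>t\<close> were a nonunit, maximality at \<open>inverse t\<close> would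
    give a polynomial over \<open>J\<close> with value in \<open>T\<close>. Clearing denominators
    with a power of \<open>t\<close>, which is again in \<open>T\<close>, produces an element of
    \<open>J\<close> in \<open>T\<close>.\<close>
  have "t \<notin> nonunits S" if t: "t \<in> T" for t
  proof
    assume "t \<in> nonunits S"
    moreover have "t \<noteq> 0" using t ideal_set_0[OF J] disj by auto
    ultimately obtain p where p: "\<And>i. coeff p i \<in> J" "poly p (inverse t) \<in> T"
      using max[of "inverse t"] by (auto simp: nonunits_def)
    have tS: "t \<in> S" using t T RS by auto
    have pow: "t ^ k \<in> T" for k using T(2,3) t by (induction k) auto
    have "t ^ degree p * poly p (inverse t) = (\<Sum>i\<le>degree p. t ^ degree p * (coeff p i * inverse t ^ i))"
      by (simp add: poly_altdef sum_distrib_left)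
    also have "\<dots> = (\<Sum>i\<le>degree p. t ^ (degree p - i) * coeff p i)"
      using \<open>t \<noteq> 0\<close> by (intro sum.cong) (auto simp: power_diff field_simps)
    also have "\<dots> \<in> J"
      using p J tS S by (intro ideal_set_sum[OF J] ideal_set_mult) (auto intro: subring_set_closed)
    finally show False using T(3)[OF pow p(2)] disj by blast
  qed
  moreover have "J \<subseteq> nonunits S"
  proof
    fix x assume x: "x \<in> J"
    have "1 \<in> J" if "x \<noteq> 0" "inverse x \<in> S"
      using ideal_set_mult[OF J that(2) x] that by simp
    then show "x \<in> nonunits S"
      using x T(2) disj ideal_set_subset[OF J x] by (auto simp: nonunits_def)
  qed
  ultimately show ?thesis using W RS J0J by blast
qed

section \<open>Lifting a chain of primes to a chain of valuation rings\<close>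

text \<open>The rings are built downwards. With \<open>m\<close> the maximal ideal of the last one,
  the next is a valuation ring above \<open>R + m\<close> whose maximal ideal contains
  \<open>P (Suc n) + m\<close>; containing \<open>m\<close> is what places it inside its
  predecessor.\<close>

lemma val_ring_chain:
  fixes R :: "'a::field set"
  assumes R: "subring_set R"
    and P: "\<And>i. i \<le> n \<Longrightarrow> prime_set (P i) R" "\<And>i. i < n \<Longrightarrow> P i \<subseteq> P (Suc i)"
  shows "\<exists>W. (\<forall>i\<le>n. val_ring (W i) \<and> R \<subseteq> W i \<and> nonunits (W i) \<inter> R = P i) \<and>
    (\<forall>i<n. W (Suc i) \<subseteq> W i)"
  using P
proof (induction n)
  case 0
  have "ideal_set (P 0) R" using 0(1)[of 0] by (simp add: prime_set_ideal)
  moreover have "s * t \<in> R - P 0" if "s \<in> R - P 0" "t \<in> R - P 0" for s t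
    using that 0(1)[of 0] prime_set_mult[of "P 0" R s t] R by (auto intro: subring_set_closed)
  moreover have "1 \<in> R - P 0" using 0(1)[of 0] R by (auto dest: prime_set_1 intro: subring_set_closed)
  ultimately obtain W where W: "val_ring W" "R \<subseteq> W" "P 0 \<subseteq> nonunits W" "nonunits W \<inter> (R - P 0) = {}"
    using exists_val_ring[OF R, of "P 0" "R - P 0"] by auto
  moreover have "P 0 \<subseteq> R" using 0(1)[of 0] by (auto dest!: prime_set_ideal ideal_set_subset)
  ultimately show ?case by (intro exI[of _ "\<lambda>_. W"]) auto
next
  case (Suc n)
  have "\<exists>W. (\<forall>i\<le>n. val_ring (W i) \<and> R \<subseteq> W i \<and> nonunits (W i) \<inter> R = P i) \<and>
      (\<forall>i<n. W (Suc i) \<subseteq> W i)"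
    by (rule Suc.IH) (use Suc.prems in auto)
  then obtain W where "\<forall>i\<le>n. val_ring (W i) \<and> R \<subseteq> W i \<and> nonunits (W i) \<inter> R = P i"
      and anti: "\<forall>i<n. W (Suc i) \<subseteq> W i"
    by blast
  then have W: "\<And>i. i \<le> n \<Longrightarrow> val_ring (W i)" "\<And>i. i \<le> n \<Longrightarrow> R \<subseteq> W i"
      "\<And>i. i \<le> n \<Longrightarrow> nonunits (W i) \<inter> R = P i"
    by simp_all
  define m where "m = nonunits (W n)"
  have Wn: "subring_set (W n)" and m: "ideal_set m (W n)" and RW: "R \<subseteq> W n" and mR: "m \<inter> R = P n"
    unfolding m_def using W(1,2,3)[of n] by (auto intro: val_ring_subring prime_set_ideal prime_set_nonunits)
  have Q: "prime_set (P (Suc n)) R" and PQ: "P n \<subseteq> P (Suc n)" using Suc.prems by auto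
  note Qi = prime_set_ideal[OF Q]
  define R' where "R' = {r + z | r z. r \<in> R \<and> z \<in> m}"
  define J where "J = {p + z | p z. p \<in> P (Suc n) \<and> z \<in> m}"
  have RR': "R \<subseteq> R'" and mJ: "m \<subseteq> J" and QJ: "P (Suc n) \<subseteq> J"
    unfolding R'_def J_def using ideal_set_0[OF m] ideal_set_0[OF Qi] by force+
  \<comment> \<open>Adding \<open>m\<close> does not enlarge the trace on \<open>R\<close>, because
    \<open>m\<close> meets \<open>R\<close> in \<open>P n\<close>, which is part of
    \<open>P (Suc n)\<close>.\<close>
  have JR: "J \<inter> R \<subseteq> P (Suc n)"
  proof
    fix x assume "x \<in> J \<inter> R"
    then obtain p z where x: "x = p + z" "p \<in> P (Suc n)" "z \<in> m" "x \<in> R" by (auto simp: J_def)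
    have "x - p \<in> R" using x(2,4) R ideal_set_subset[OF Qi] by (auto intro: subring_set_diff)
    then have "z \<in> R" using x(1) by simp
    then have "z \<in> P (Suc n)" using x mR PQ by auto
    then show "x \<in> P (Suc n)" using x Qi by (auto intro: ideal_set_add)
  qed
  have "subring_set R'"
    unfolding subring_set_def
  proof (intro conjI ballI)
    show "1 \<in> R'" using RR' R by (auto intro: subring_set_closed)
    fix x y assume "x \<in> R'" "y \<in> R'"
    then obtain r z s w where *: "x = r + z" "y = s + w" "r \<in> R" "s \<in> R" "z \<in> m" "w \<in> m"
      by (auto simp: R'_def)
    have "x - y = (r - s) + (z - w)" "r - s \<in> R" "z - w \<in> m"
      using * R Wn m by (auto intro: subring_set_closed ideal_set_diff)
    then show "x - y \<in> R'" unfolding R'_def by blast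
    have y: "y \<in> W n" "r \<in> W n"
      using * RW ideal_set_subset[OF m] Wn by (auto intro: subring_set_closed)
    have "x * y = r * s + (r * w + y * z)" using * by (simp add: algebra_simps)
    moreover have "r * w + y * z \<in> m"
      using * m y by (intro ideal_set_add[OF m] ideal_set_mult[OF m])
    moreover have "r * s \<in> R" using * R by (auto intro: subring_set_closed)
    ultimately show "x * y \<in> R'" unfolding R'_def by blast
  qed
  moreover have "ideal_set J R'"
    unfolding ideal_set_def
  proof (intro conjI ballI)
    show "J \<subseteq> R'" using ideal_set_subset[OF Qi] by (auto simp: J_def R'_def)
    show "0 \<in> J" using mJ m by (auto intro: ideal_set_0)
    show "x + y \<in> J" if xy: "x \<in> J" "y \<in> J" for x y
    proof -
      obtain r z s w where *: "x = r + z" "y = s + w" "r \<in> P (Suc n)" "s \<in> P (Suc n)" "z \<in> m" "w \<in> m"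
        using xy by (auto simp: J_def)
      then have "x + y = (r + s) + (z + w)" "r + s \<in> P (Suc n)" "z + w \<in> m"
        using m Qi by (auto intro: ideal_set_add)
      then show ?thesis unfolding J_def by blast
    qed
    show "x * y \<in> J" if xy: "x \<in> R'" "y \<in> J" for x y
    proof -
      obtain r z s w where *: "x = r + z" "y = s + w" "r \<in> R" "s \<in> P (Suc n)" "z \<in> m" "w \<in> m"
        using xy by (auto simp: J_def R'_def)
      then have y: "y \<in> W n" "r \<in> W n"
        using RW ideal_set_subset[OF Qi] ideal_set_subset[OF m] Wn by (auto intro: subring_set_closed)
      have "x * y = r * s + (r * w + y * z)" using * by (simp add: algebra_simps)
      moreover have "r * w + y * z \<in> m"
        using * m y by (intro ideal_set_add[OF m] ideal_set_mult[OF m])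
      moreover have "r * s \<in> P (Suc n)" using * Qi by (auto intro: ideal_set_mult)
      ultimately show ?thesis unfolding J_def by blast
    qed
  qed
  moreover have "s * t \<in> R - P (Suc n)" if "s \<in> R - P (Suc n)" "t \<in> R - P (Suc n)" for s t
    using that prime_set_mult[OF Q, of s t] R by (auto intro: subring_set_closed)
  moreover have "1 \<in> R - P (Suc n)" using Q R by (auto dest: prime_set_1 intro: subring_set_closed)
  moreover have "J \<inter> (R - P (Suc n)) = {}" using JR by blast
  ultimately obtain V where V: "val_ring V" "R' \<subseteq> V" "J \<subseteq> nonunits V"
      "nonunits V \<inter> (R - P (Suc n)) = {}"
    using exists_val_ring[of R' J "R - P (Suc n)"] RR' by blast
  define W' where "W' = (\<lambda>i. if i \<le> n then W i else V)"
  have "nonunits (W n) \<subseteq> nonunits V" using V(3) mJ unfolding m_def by blast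
  then have "V \<subseteq> W n"
    by (rule val_ring_subset_if_nonunits[OF W(1)[OF order.refl] val_ring_subring[OF V(1)]])
  moreover have "nonunits V \<inter> R = P (Suc n)"
    using V QJ ideal_set_subset[OF Qi] by blast
  moreover have "R \<subseteq> V" using V(2) RR' by blast
  ultimately have "\<forall>i\<le>Suc n. val_ring (W' i) \<and> R \<subseteq> W' i \<and> nonunits (W' i) \<inter> R = P i"
    and "\<forall>i<Suc n. W' (Suc i) \<subseteq> W' i"
    using V(1) W anti by (simp_all add: W'_def le_Suc_eq less_Suc_eq)
  then show ?case by blast
qed

lemma prime_set_vimage:
  assumes f: "f 0 = 0" "f 1 = 1" "\<And>x y. f (x + y) = f x + f y" "\<And>x y. f (x * y) = f x * f y"
    and R: "subring_set R" "f ` R \<subseteq> S" and P: "prime_set P S"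
  shows "prime_set {x \<in> R. f x \<in> P} R"
  unfolding prime_set_def ideal_set_def
proof (intro conjI ballI impI)
  note Pi = prime_set_ideal[OF P]
  show "{x \<in> R. f x \<in> P} \<subseteq> R" by blast
  show "0 \<in> {x \<in> R. f x \<in> P}" "1 \<notin> {x \<in> R. f x \<in> P}"
    using subring_set_0[OF R(1)] ideal_set_0[OF Pi] prime_set_1[OF P] f by auto
  show "x + y \<in> {x \<in> R. f x \<in> P}" if "x \<in> {x \<in> R. f x \<in> P}" "y \<in> {x \<in> R. f x \<in> P}" for x y
    using that subring_set_add[OF R(1)] ideal_set_add[OF Pi] f by auto
  show "s * x \<in> {x \<in> R. f x \<in> P}" if "s \<in> R" "x \<in> {x \<in> R. f x \<in> P}" for s x
    using that subring_set_mult[OF R(1)] ideal_set_mult[OF Pi] f R(2) by auto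
  show "x \<in> {x \<in> R. f x \<in> P} \<or> y \<in> {x \<in> R. f x \<in> P}"
    if "x \<in> R" "y \<in> R" "x * y \<in> {x \<in> R. f x \<in> P}" for x y
  proof -
    have "f x \<in> S" "f y \<in> S" using that R(2) by blast+
    then show ?thesis using that prime_set_mult[OF P, of "f x" "f y"] f(4) by auto
  qed
qed

text \<open>The prime is the contraction to \<open>R\<close> of the maximal ideal of a valuation
  ring, so no second appeal to Zorn's lemma is made.\<close>

lemma exists_prime_set:
  fixes R :: "'a::field set"
  assumes R: "subring_set R" and J: "ideal_set J R" "1 \<notin> J"
  shows "\<exists>P. prime_set P R \<and> J \<subseteq> P"
proof -
  obtain W where W: "val_ring W" "R \<subseteq> W" "J \<subseteq> nonunits W"
    using exists_val_ring[OF R J(1), of "{1}"] J(2) R by (auto intro: subring_set_closed)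
  have "prime_set {x \<in> R. id x \<in> nonunits W} R"
    by (rule prime_set_vimage[OF _ _ _ _ R _ prime_set_nonunits[OF W(1)]]) (use W in auto)
  then show ?thesis using W J ideal_set_subset[OF J(1)] by (auto intro!: exI)
qed

section \<open>Valuation rings of the rational function field\<close>

definition unit_set :: "'a::field set \<Rightarrow> 'a set" where
  "unit_set W = {x \<in> W. x \<noteq> 0 \<and> inverse x \<in> W}"

lemma unit_set_mono: "W' \<subseteq> W \<Longrightarrow> unit_set W' \<subseteq> unit_set W"
  by (auto simp: unit_set_def)

lemma unit_set_mult: "subring_set W \<Longrightarrow> x \<in> unit_set W \<Longrightarrow> y \<in> unit_set W \<Longrightarrow> x * y \<in> unit_set W"
  by (auto simp: unit_set_def intro: subring_set_closed)

lemma unit_set_inverse: "x \<in> unit_set W \<Longrightarrow> inverse x \<in> unit_set W"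
  by (auto simp: unit_set_def)

lemma unit_set_power: "subring_set W \<Longrightarrow> x \<in> unit_set W \<Longrightarrow> x ^ n \<in> unit_set W"
  by (auto simp: unit_set_def power_inverse[symmetric] intro: subring_set_closed)

lemma unit_set_powi: "subring_set W \<Longrightarrow> x \<in> unit_set W \<Longrightarrow> x powi n \<in> unit_set W"
  by (auto simp: power_int_def unit_set_power unit_set_inverse)

lemma unit_set_cancel:
  assumes W: "subring_set W" and x: "x \<in> unit_set W" and xy: "x * y \<in> unit_set W"
  shows "y \<in> unit_set W"
proof -
  have "inverse x * (x * y) = y" using x by (simp add: unit_set_def field_simps)
  then show ?thesis using unit_set_mult[OF W unit_set_inverse[OF x] xy] by metis
qed

text \<open>The value group is torsion-free: \<open>x\<close> or \<open>inverse x\<close> lies in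
  \<open>W\<close>, and positive powers of nonunits are nonunits.\<close>

lemma unit_set_powi_root:
  assumes W: "val_ring W" and x: "x powi s \<in> unit_set W" "s \<noteq> 0"
  shows "x \<in> unit_set W"
proof -
  obtain n where "x ^ Suc n \<in> unit_set W"
  proof -
    have "x ^ nat \<bar>s\<bar> \<in> unit_set W"
      using x unit_set_inverse[OF x(1)] by (cases "s \<ge> 0") (auto simp: power_int_def power_inverse)
    then show ?thesis using that[of "nat \<bar>s\<bar> - 1"] x(2) by simp
  qed
  note x = this unit_set_inverse[OF this]
  have *: "y ^ Suc n \<notin> unit_set W" if "y \<in> nonunits W" for y
  proof -
    have "y ^ n * y \<in> nonunits W"
      using that val_ring_subring[OF W] by (intro nonunits_mult subring_set_power) (auto simp: nonunits_def)
    then show ?thesis by (simp add: unit_set_def nonunits_def mult.commute)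
  qed
  have "x \<noteq> 0" using x(1) by (auto simp: unit_set_def)
  then show ?thesis
    using *[of x] *[of "inverse x"] x val_ring_total[OF W, of x]
    by (auto simp: unit_set_def nonunits_def power_inverse)
qed

lemma nonunits_iff: "x \<in> nonunits W \<longleftrightarrow> x \<in> W \<and> x \<notin> unit_set W"
  by (auto simp: unit_set_def nonunits_def)

section \<open>Algebraic dependence in the rational function field and its effect on values\<close>

text \<open>Gaussian elimination on the top coefficient: a pivot \<open>f b\<close> clears position
  \<open>n\<close> in all other members, leaving one polynomial and one coefficient position fewer.
  The family is indexed, so repetitions count as dependent.\<close>

lemma poly_linear_dependence:
  fixes f :: "'b \<Rightarrow> 'a::field poly"
  assumes "finite A" "n < card A" "\<And>a k. a \<in> A \<Longrightarrow> n \<le> k \<Longrightarrow> coeff (f a) k = 0"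
  shows "\<exists>c. (\<exists>a\<in>A. c a \<noteq> 0) \<and> (\<Sum>a\<in>A. smult (c a) (f a)) = 0"
  using assms
proof (induction n arbitrary: A f)
  case 0
  then have "\<And>a. a \<in> A \<Longrightarrow> f a = 0" by (intro poly_eqI) auto
  moreover have "A \<noteq> {}" using 0(2) by auto
  ultimately show ?case by (intro exI[of _ "\<lambda>_. 1"]) auto
next
  case (Suc n)
  show ?case
  proof (cases "\<forall>a\<in>A. coeff (f a) n = 0")
    case True
    then have "coeff (f a) k = 0" if "a \<in> A" "n \<le> k" for a k
      using Suc.prems(3)[of a k] that by (cases "k = n") auto
    then show ?thesis using Suc.prems by (intro Suc.IH) auto
  next
    case False
    then obtain b where b: "b \<in> A" "coeff (f b) n \<noteq> 0" by blast
    define l where "l = (\<lambda>a. coeff (f a) n / coeff (f b) n)"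
    define g where "g = (\<lambda>a. f a - smult (l a) (f b))"
    have "\<exists>c. (\<exists>a\<in>A - {b}. c a \<noteq> 0) \<and> (\<Sum>a\<in>A - {b}. smult (c a) (g a)) = 0"
    proof (rule Suc.IH)
      show "coeff (g a) k = 0" if "a \<in> A - {b}" "n \<le> k" for a k
        using that Suc.prems(3)[of a k] Suc.prems(3)[of b k] b
        by (cases "k = n") (auto simp: g_def l_def)
    qed (use Suc.prems b in auto)
    then obtain c where c: "\<exists>a\<in>A - {b}. c a \<noteq> 0" "(\<Sum>a\<in>A - {b}. smult (c a) (g a)) = 0" by blast
    \<comment> \<open>The new coefficient at \<open>b\<close> collects the multiples of
      \<open>f b\<close> that were subtracted in \<open>g\<close>.\<close>
    define c' where "c' = c(b := - (\<Sum>a\<in>A - {b}. c a * l a))"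
    have "(\<Sum>a\<in>A. smult (c' a) (f a)) = smult (c' b) (f b) + (\<Sum>a\<in>A - {b}. smult (c' a) (f a))"
      using Suc.prems b by (simp add: sum.remove)
    also have "(\<Sum>a\<in>A - {b}. smult (c' a) (f a)) = (\<Sum>a\<in>A - {b}. smult (c a) (f a))"
      by (intro sum.cong) (auto simp: c'_def)
    also have "smult (c' b) (f b) + \<dots> = (\<Sum>a\<in>A - {b}. smult (c a) (g a))"
      by (simp add: c'_def g_def smult_diff_right sum_subtractf smult_sum)
    finally have "(\<Sum>a\<in>A. smult (c' a) (f a)) = 0" using c(2) by simp
    moreover have "\<exists>a\<in>A. c' a \<noteq> 0" using c(1) by (auto simp: c'_def)
    ultimately show ?thesis by blast
  qed
qed

text \<open>In a vanishing sum the least value is attained at least twice. After division by a term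
  \<open>u m\<close> of least value, the other terms sum to \<open>- 1\<close>; if none of them were
  a unit, \<open>- 1\<close> would be a nonunit.\<close>

lemma sum_eq_0_unit_ratio:
  fixes u :: "'b \<Rightarrow> 'a::field"
  assumes W: "val_ring W" and A: "finite A" and sum: "sum u A = 0" and nz: "\<exists>i\<in>A. u i \<noteq> 0"
  shows "\<exists>i\<in>A. \<exists>j\<in>A. i \<noteq> j \<and> u i \<noteq> 0 \<and> u j \<noteq> 0 \<and> u i / u j \<in> unit_set W"
proof -
  define A' where "A' = {i \<in> A. u i \<noteq> 0}"
  have A': "finite A'" "A' \<noteq> {}" using A nz by (auto simp: A'_def)
  note S = val_ring_subring[OF W]
  have "\<exists>m\<in>A'. \<forall>i\<in>A'. u i / u m \<in> W"
    using A' 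
  proof (induction A' rule: finite_ne_induct)
    case (insert a F)
    then obtain m where m: "m \<in> F" "\<And>i. i \<in> F \<Longrightarrow> u i / u m \<in> W" by blast
    show ?case
    proof (cases "u a / u m \<in> W")
      case False
      have "u m / u a \<in> W"
        using val_ring_total[OF W, of "u a / u m"] False by (simp add: field_simps)
      moreover have "u m \<noteq> 0" using False subring_set_0[OF S] by auto
      moreover have "u a / u a \<in> W" using subring_set_0[OF S] subring_set_1[OF S] by auto
      ultimately have "u i / u a \<in> W" if "i \<in> insert a F" for i
        using subring_set_mult[OF S m(2)[of i], of "u m / u a"] that by auto
      then show ?thesis by blast
    qed (use m in auto)
  qed (use S in \<open>auto intro: subring_set_closed\<close>)
  then obtain m where m: "m \<in> A'" "\<And>i. i \<in> A' \<Longrightarrow> u i / u m \<in> W" by blast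
  show ?thesis
  proof (rule ccontr)
    assume *: "\<not> ?thesis"
    have "u i / u m \<in> nonunits W" if "i \<in> A' - {m}" for i
      using * m that by (auto simp: nonunits_iff A'_def)
    then have "(\<Sum>i\<in>A' - {m}. u i / u m) \<in> nonunits W"
      by (intro ideal_set_sum[OF prime_set_ideal[OF prime_set_nonunits[OF W]]])
    moreover have "sum u A' = sum u A"
      by (rule sum.mono_neutral_left) (use A in \<open>auto simp: A'_def\<close>)
    then have "sum u A' = 0" using sum by simp
    then have "(\<Sum>i\<in>A'. u i / u m) = 0" by (simp add: sum_divide_distrib[symmetric])
    then have "(\<Sum>i\<in>A' - {m}. u i / u m) = - 1"
      using A' m by (simp add: sum.remove A'_def eq_neg_iff_add_eq_0 add.commute)
    ultimately show False
      using S by (auto simp: nonunits_def intro: subring_set_closed)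
  qed
qed

abbreviation const_fract :: "'k::field \<Rightarrow> 'k poly fract" where
  "const_fract c \<equiv> to_fract [:c:]"

lemma const_fract_hom:
  "const_fract 0 = 0" "const_fract 1 = 1" "const_fract (a + b) = const_fract a + const_fract b"
  "const_fract (a - b) = const_fract a - const_fract b"
  "const_fract (a * b) = const_fract a * const_fract b"
  by (simp_all add: to_fract_def mult.commute one_pCons Zero_fract_def One_fract_def)

lemma const_fract_inverse: "const_fract (inverse c) = inverse (const_fract c)"
proof (cases "c = 0")
  case False
  then have "const_fract (inverse c) * const_fract c = 1"
    by (simp flip: const_fract_hom(5) add: const_fract_hom(2))
  then show ?thesis by (metis inverse_unique mult.commute)
qed (simp add: const_fract_hom)

lemma const_fract_divide: "const_fract (a / b) = const_fract a / const_fract b"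
  by (simp add: divide_inverse const_fract_hom const_fract_inverse)

lemma const_fract_eq_0_iff [simp]: "const_fract c = 0 \<longleftrightarrow> c = 0"
  by (simp add: to_fract_def Zero_fract_def eq_fract)

lemma to_fract_power: "to_fract (p ^ n) = to_fract p ^ n"
  by (induction n) auto

lemma to_fract_sum: "to_fract (sum f A) = (\<Sum>a\<in>A. to_fract (f a))"
  by (induction A rule: infinite_finite_induct) auto

text \<open>Transcendence degree one, by counting dimensions. After clearing the common denominator
  \<open>Q\<close>, the \<open>(N + 1)^2\<close> monomials become polynomials of degree at most
  \<open>2 * N * d\<close>, and \<open>N = 2 * d + 1\<close> makes \<open>(N + 1)^2\<close> exceed
  \<open>2 * N * d + 1\<close>.\<close>

lemma algebraic_dependence:
  fixes x y :: "'k::field poly fract"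
  shows "\<exists>N c. (\<exists>i\<in>{..N} \<times> {..N}. c i \<noteq> 0) \<and>
    (\<Sum>(k, l)\<in>{..N} \<times> {..N}. const_fract (c (k, l)) * x ^ k * y ^ l) = 0"
proof -
  obtain p q r s where xy: "x = Fract p q" "y = Fract r s" and qs: "q \<noteq> 0" "s \<noteq> 0"
    by (metis Fract_cases)
  define a b Q where "a = p * s" and "b = r * q" and "Q = q * s"
  have Q: "to_fract Q \<noteq> 0" using qs by (simp add: Q_def to_fract_def Zero_fract_def eq_fract)
  have a: "to_fract a = x * to_fract Q" and b: "to_fract b = y * to_fract Q"
    using qs by (simp_all add: a_def b_def Q_def xy to_fract_def eq_fract)
  define d where "d = max (degree a) (max (degree b) (degree Q))"
  define N where "N = 2 * d + 1"
  let ?A = "{..N} \<times> {..N}"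
  \<comment> \<open>The exponent of \<open>Q\<close> is chosen so that every monomial
    \<open>x ^ k * y ^ l\<close> is multiplied by the same factor
    \<open>Q ^ (2 * N)\<close>.\<close>
  define f where "f = (\<lambda>(k, l). a ^ k * b ^ l * Q ^ (2 * N - k - l))"
  have deg: "degree (f i) \<le> 2 * N * d" if iA: "i \<in> ?A" for i
  proof -
    obtain k l where i: "i = (k, l)" "k \<le> N" "l \<le> N"
      using iA by auto
    have pow: "degree (h ^ m) \<le> m * d" if "degree h \<le> d" for h :: "'k poly" and m
      using degree_power_le[of h m] mult_le_mono[OF that order.refl, of m]
      by (metis order.trans mult.commute)
    have "degree (f i) \<le> degree (a ^ k) + degree (b ^ l) + degree (Q ^ (2 * N - k - l))"
      unfolding f_def i by (auto intro!: order.trans[OF degree_mult_le] add_mono)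
    also have "\<dots> \<le> k * d + l * d + (2 * N - k - l) * d"
      by (intro add_mono pow) (auto simp: d_def)
    also have "\<dots> = 2 * N * d" using i by (simp flip: add_mult_distrib)
    finally show ?thesis .
  qed
  have "2 * N * d + 1 < card ?A" by (simp add: N_def algebra_simps)
  moreover have "coeff (f i) k = 0" if "i \<in> ?A" "2 * N * d + 1 \<le> k" for i k
    using deg[OF that(1)] that(2) by (intro coeff_eq_0) auto
  ultimately obtain c where c: "\<exists>i\<in>?A. c i \<noteq> 0" "(\<Sum>i\<in>?A. smult (c i) (f i)) = 0"
    using poly_linear_dependence[of ?A "2 * N * d + 1" f] by auto
  have "to_fract (smult (c (k, l)) (f (k, l))) = (const_fract (c (k, l)) * x ^ k * y ^ l) * to_fract Q ^ (2 * N)"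
    if "k \<le> N" "l \<le> N" for k l
  proof -
    have "k + l + (2 * N - k - l) = 2 * N" using that by simp
    then have "to_fract Q ^ (2 * N) = to_fract Q ^ k * to_fract Q ^ l * to_fract Q ^ (2 * N - k - l)"
      by (simp flip: power_add)
    moreover have "smult (c (k, l)) (f (k, l)) = [:c (k, l):] * f (k, l)" by simp
    ultimately show ?thesis
      by (simp only: f_def prod.case to_fract_mult to_fract_power a b power_mult_distrib mult_ac)
  qed
  then have "to_fract (\<Sum>i\<in>?A. smult (c i) (f i)) =
      (\<Sum>(k, l)\<in>?A. const_fract (c (k, l)) * x ^ k * y ^ l) * to_fract Q ^ (2 * N)"
    unfolding to_fract_sum sum_distrib_right by (intro sum.cong) auto
  then show ?thesis using c Q by (intro exI[of _ N] exI[of _ c]) auto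
qed

text \<open>Two different terms of an algebraic relation have the same value by
  \<open>sum_eq_0_unit_ratio\<close>. Their quotient is the monomial, and its exponents are not both
  zero because the index pairs differ.\<close>

lemma exists_unit_monomial:
  fixes x y :: "'k::field poly fract"
  assumes W: "val_ring W" and xy: "x \<noteq> 0" "y \<noteq> 0"
  shows "\<exists>c s t. c \<noteq> 0 \<and> (s \<noteq> 0 \<or> t \<noteq> 0) \<and> const_fract c * x powi s * y powi t \<in> unit_set W"
proof -
  obtain N and c :: "nat \<times> nat \<Rightarrow> 'k" where c: "\<exists>i\<in>{..N} \<times> {..N}. c i \<noteq> 0"
    and sum: "(\<Sum>(k, l)\<in>{..N} \<times> {..N}. const_fract (c (k, l)) * x ^ k * y ^ l) = 0"
    using algebraic_dependence[of x y] by blast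
  define u where "u = (\<lambda>(k, l). const_fract (c (k, l)) * x ^ k * y ^ l)"
  have u0: "u i = 0 \<longleftrightarrow> c i = 0" for i using xy by (auto simp: u_def split: prod.split)
  obtain i j where ij: "i \<noteq> j" "u i \<noteq> 0" "u j \<noteq> 0" "u i / u j \<in> unit_set W"
    using sum_eq_0_unit_ratio[OF W, of "{..N} \<times> {..N}" u] sum c by (auto simp: u0) (auto simp: u_def)
  obtain k l k' l' where kl: "i = (k, l)" "j = (k', l')" by (meson surj_pair)
  have "u i / u j = const_fract (c i / c j) * x powi (int k - int k') * y powi (int l - int l')"
    using xy by (simp add: u_def kl const_fract_divide power_int_diff)
  then show ?thesis
    using ij kl by (intro exI[of _ "c i / c j"] exI[of _ "int k - int k'"] exI[of _ "int l - int l'"])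
      (auto simp: u0)
qed

text \<open>Either \<open>c\<close> or its inverse lies in \<open>U'\<close>. Were \<open>c\<close>
  not a unit there, that element would be in the maximal ideal of \<open>U'\<close>, hence by
  \<open>eq\<close> in that of \<open>U\<close>, where it is a unit.\<close>

lemma const_fract_unit_set_step:
  fixes U U' :: "'k::field poly fract set"
  assumes U: "val_ring U'" and eq: "const_fract -` nonunits U' \<subseteq> const_fract -` nonunits U"
    and c: "const_fract c \<in> unit_set U"
  shows "const_fract c \<in> unit_set U'"
proof (rule ccontr)
  assume n: "const_fract c \<notin> unit_set U'"
  then consider "const_fract c \<in> nonunits U'" | "const_fract (inverse c) \<in> nonunits U'"
    using val_ring_total[OF U, of "const_fract c"] c
    by (auto simp: nonunits_def unit_set_def const_fract_inverse)
  then show False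
  proof cases
    case 1
    then show ?thesis using eq c by (auto simp: nonunits_iff)
  next
    case 2
    then have "const_fract (inverse c) \<in> nonunits U" using eq by blast
    then show ?thesis using unit_set_inverse[OF c] by (simp add: nonunits_iff const_fract_inverse)
  qed
qed

text \<open>Two jumps not witnessed by constants would give elements \<open>x\<close>, \<open>y\<close> whose values are independent
  modulo the values of constants; but \<open>K(X)\<close> has
  transcendence degree one over \<open>K\<close>.\<close>

lemma nonunits_two_jumps:
  fixes U0 U1 U2 U3 :: "'k::field poly fract set"
  assumes val: "val_ring U0" "val_ring U1" "val_ring U2" "val_ring U3"
    and sub: "U1 \<subseteq> U0" "U2 \<subseteq> U1" "U3 \<subseteq> U2"
    and jump: "\<not> nonunits U1 \<subseteq> nonunits U0" "\<not> nonunits U3 \<subseteq> nonunits U2"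
    and const: "const_fract -` nonunits U1 \<subseteq> const_fract -` nonunits U0"
      "const_fract -` nonunits U3 \<subseteq> const_fract -` nonunits U2"
  shows False
proof -
  note S = val[THEN val_ring_subring]
  obtain x where "x \<in> nonunits U1" "x \<notin> nonunits U0" using jump(1) by blast
  then have x: "x \<in> unit_set U0" "x \<notin> unit_set U1"
    using sub(1) by (auto simp: nonunits_iff)
  obtain y where "y \<in> nonunits U3" "y \<notin> nonunits U2" using jump(2) by blast
  then have y: "y \<in> unit_set U2" "y \<notin> unit_set U3"
    using sub(3) by (auto simp: nonunits_iff)
  have "x \<noteq> 0" "y \<noteq> 0" using x y by (auto simp: unit_set_def)
  from exists_unit_monomial[OF val(4) this]
  obtain c s t where c: "c \<noteq> 0" "s \<noteq> 0 \<or> t \<noteq> 0"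
    and u: "const_fract c * x powi s * y powi t \<in> unit_set U3"
    by (elim exE conjE)
  show False
  proof (cases "s = 0")
    \<comment> \<open>Only \<open>y\<close> enters: \<open>c\<close> is a unit in \<open>U2\<close>
      because \<open>y\<close> is, stays one in \<open>U3\<close>, and so a nonzero power of
      \<open>y\<close> is a unit in \<open>U3\<close>.\<close>
    case True
    then have cy: "const_fract c * y powi t \<in> unit_set U3" using u by simp
    then have "y powi t * const_fract c \<in> unit_set U2"
      using unit_set_mono[OF sub(3)] by (metis mult.commute subsetD)
    then have "const_fract c \<in> unit_set U2"
      by (rule unit_set_cancel[OF S(3) unit_set_powi[OF S(3) y(1)]])
    then have "const_fract c \<in> unit_set U3"
      by (rule const_fract_unit_set_step[OF val(4) const(2)])
    then have "y powi t \<in> unit_set U3" using cy by (rule unit_set_cancel[OF S(4)])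
    then show False using unit_set_powi_root[OF val(4), of y t] y(2) c(2) True by simp
  next
    case False
    \<comment> \<open>Already in \<open>U1\<close> the factor \<open>y\<close> is a unit and
      cancels, so the argument for \<open>y\<close> can be repeated for \<open>x\<close> with
      \<open>U0\<close> and \<open>U1\<close>.\<close>
    have "y \<in> unit_set U1" using y(1) unit_set_mono[OF sub(2)] by blast
    moreover have "const_fract c * x powi s * y powi t \<in> unit_set U1"
      using u unit_set_mono[OF sub(2)] unit_set_mono[OF sub(3)] by blast
    then have "y powi t * (const_fract c * x powi s) \<in> unit_set U1"
      by (metis mult.commute)
    ultimately have cx: "const_fract c * x powi s \<in> unit_set U1"
      by (rule unit_set_cancel[OF S(2) unit_set_powi[OF S(2)]])
    then have "x powi s * const_fract c \<in> unit_set U0"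
      using unit_set_mono[OF sub(1)] by (metis mult.commute subsetD)
    then have "const_fract c \<in> unit_set U0"
      by (rule unit_set_cancel[OF S(1) unit_set_powi[OF S(1) x(1)]])
    then have "const_fract c \<in> unit_set U1"
      by (rule const_fract_unit_set_step[OF val(2) const(1)])
    then have "x powi s \<in> unit_set U1" using cx by (rule unit_set_cancel[OF S(2)])
    then show False using unit_set_powi_root[OF val(2), of x s] x(2) False by simp
  qed
qed

section \<open>Upper bound by the valuative dimension\<close>

text \<open>Of the \<open>n\<close> strict inclusions at most one becomes an equality in
  \<open>V\<close>, so \<open>V\<close> has a chain of length \<open>n - 1\<close>.\<close>

lemma krull_dim_le_valuative_dim:
  fixes R :: "'k::field poly fract set"
  assumes R: "subring_set R" and B: "quotient_field B = UNIV" "const_fract ` B \<subseteq> R"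
  shows "krull_dim (ring_on R) \<le> 1 + valuative_dim B"
proof (rule krull_dim_le[OF R])
  fix n P assume P: "\<And>i. i \<le> n \<Longrightarrow> prime_set (P i) R" "\<And>i. i < n \<Longrightarrow> P i \<subset> P (Suc i)"
  show "enat n \<le> 1 + valuative_dim B"
  proof (cases n)
    case 0
    then show ?thesis by (simp add: zero_enat_def[symmetric])
  next
    case (Suc n')
    obtain W where W: "\<And>i. i \<le> n \<Longrightarrow> val_ring (W i)" "\<And>i. i \<le> n \<Longrightarrow> R \<subseteq> W i"
        "\<And>i. i \<le> n \<Longrightarrow> nonunits (W i) \<inter> R = P i" "\<And>i. i < n \<Longrightarrow> W (Suc i) \<subseteq> W i"
      using val_ring_chain[OF R, of n P] P by (metis psubset_imp_subset)
    have anti: "W j \<subseteq> W i" if "i \<le> j" "j \<le> n" for i j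
      using that by (induction j rule: dec_induct) (use W(4) in \<open>auto simp: Suc_le_eq\<close>)
    define V where "V = const_fract -` W n"
    define N where "N = (\<lambda>i. const_fract -` nonunits (W i))"
    have V: "val_ring V"
      unfolding val_ring_def subring_set_def V_def
      using subring_set_1[of "W n"] subring_set_diff[of "W n"] subring_set_mult[of "W n"]
        W(1)[of n] val_ring_total[of "W n"]
      by (auto simp: const_fract_hom const_fract_inverse val_ring_subring)
    have "V \<in> valuation_overrings B"
    proof -
      have BV: "B \<subseteq> V" using B(2) W(2)[of n] by (auto simp: V_def)
      then show ?thesis
        using V B(1) by (auto simp: valuation_overrings_def valuation_ring_def
            subring_set_iff_subdomain val_ring_def)
    qed
    then have le: "krull_dim (ring_on V) \<le> valuative_dim B"
      unfolding valuative_dim_def by (rule SUP_upper)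
    have prime: "prime_set (N i) V" if i: "i \<le> n" for i
    proof -
      \<comment> \<open>Larger valuation rings have smaller maximal ideals, so each
        \<open>N i\<close> lies in the smallest contraction \<open>V\<close>.\<close>
      have "nonunits (W i) \<subseteq> W n"
        using nonunits_mono[OF W(1) W(1) anti[OF i]] i by (auto simp: nonunits_def)
      then have "N i = {c \<in> V. const_fract c \<in> nonunits (W i)}" by (auto simp: N_def V_def)
      moreover have "const_fract ` V \<subseteq> W i" using anti[OF i] by (auto simp: V_def)
      ultimately show ?thesis
        using prime_set_vimage[OF _ _ _ _ val_ring_subring[OF V] _ prime_set_nonunits[OF W(1)[OF i]],
            of const_fract] by (simp add: const_fract_hom)
    qed
    have mono: "N i \<subseteq> N (Suc i)" if "i < n" for i
      using nonunits_mono[OF W(1) W(1) W(4)[OF that]] that by (auto simp: N_def)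
    have jump: "\<not> nonunits (W (Suc i)) \<subseteq> nonunits (W i)" if "i < n" for i
      using W(3)[of i] W(3)[of "Suc i"] P(2)[OF that] that by auto
    \<comment> \<open>An equality of neighbours is a jump not witnessed by constants. The case
      \<open>j = Suc i\<close> is included, the middle two rings then being equal.\<close>
    have two: False if ij: "i < j" "j < n" "N i = N (Suc i)" "N j = N (Suc j)" for i j
      by (rule nonunits_two_jumps[of "W i" "W (Suc i)" "W j" "W (Suc j)"])
        (use ij W anti jump in \<open>auto simp: N_def\<close>)
    obtain i0 where i0: "\<And>i. i < n \<Longrightarrow> i \<noteq> i0 \<Longrightarrow> N i \<subset> N (Suc i)"
    proof (cases "\<exists>i<n. N i = N (Suc i)")
      case True
      then obtain i where "i < n" "N i = N (Suc i)" by blast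
      then have "N j \<subset> N (Suc j)" if "j < n" "j \<noteq> i" for j
        using that two[of i j] two[of j i] mono[of j] by (cases "i < j") auto
      then show ?thesis using that by blast
    next
      case False
      then show ?thesis using that[of 0] mono by blast
    qed
    \<comment> \<open>The chain omits \<open>N (Suc i0)\<close>. If no neighbours coincide,
      \<open>i0\<close> is 0 and a member is dropped all the same.\<close>
    define Q where "Q = (\<lambda>k. N (if k \<le> i0 then k else Suc k))"
    have "Q k \<subset> Q (Suc k)" if "k < n'" for k
    proof -
      consider "k < i0" | "k = i0" | "k > i0" by linarith
      then show ?thesis
      proof cases
        case 1
        then show ?thesis using i0[of k] that Suc by (simp add: Q_def)
      next
        case 2
        then show ?thesis using i0[of "Suc k"] mono[of k] that Suc by (simp add: Q_def subset_psubset_trans)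
      next
        case 3
        then show ?thesis using i0[of "Suc k"] that Suc by (simp add: Q_def)
      qed
    qed
    then have "enat n' \<le> krull_dim (ring_on V)"
      using prime Suc by (intro le_krull_dim[of V n' Q]) (auto simp: Q_def V val_ring_subring)
    then have "enat n' \<le> valuative_dim B" using le by (rule order.trans)
    then have "1 + enat n' \<le> 1 + valuative_dim B" by (rule add_left_mono)
    then show ?thesis using Suc by (simp add: one_enat_def)
  qed
qed

section \<open>Domains sharing an ideal\<close>

text \<open>Multiplication by elements of \<open>J\<close> carries \<open>B\<close> into
  \<open>A\<close>, where \<open>P\<close> is prime. An element of \<open>J\<close> outside
  \<open>P\<close> shows that the lift is proper and has no further elements in
  \<open>A\<close>.\<close>

lemma shared_ideal_lift:
  assumes A: "subring_set A" "A \<subseteq> B" and B: "subring_set B" and J: "ideal_set J A" "ideal_set J B"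
    and P: "prime_set P A" "\<not> J \<subseteq> P"
  shows "prime_set {x \<in> B. \<forall>j\<in>J. x * j \<in> P} B" and "{x \<in> B. \<forall>j\<in>J. x * j \<in> P} \<inter> A = P"
proof -
  note Pi = prime_set_ideal[OF P(1)]
  obtain j0 where j0: "j0 \<in> J" "j0 \<notin> P" using P(2) by blast
  show "{x \<in> B. \<forall>j\<in>J. x * j \<in> P} \<inter> A = P"
  proof (intro equalityI subsetI)
    fix x assume "x \<in> {x \<in> B. \<forall>j\<in>J. x * j \<in> P} \<inter> A"
    then show "x \<in> P" using prime_set_mult[OF P(1), of x j0] j0 ideal_set_subset[OF J(1)] by auto
  next
    fix x assume "x \<in> P"
    then show "x \<in> {x \<in> B. \<forall>j\<in>J. x * j \<in> P} \<inter> A"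
      using ideal_set_subset[OF Pi] A(2) ideal_set_mult'[OF Pi ideal_set_subset[OF J(1)]] by auto
  qed
  show "prime_set {x \<in> B. \<forall>j\<in>J. x * j \<in> P} B"
    unfolding prime_set_def ideal_set_def
  proof (intro conjI ballI impI)
    let ?Q = "{x \<in> B. \<forall>j\<in>J. x * j \<in> P}"
    show "?Q \<subseteq> B" by blast
    show "0 \<in> ?Q" using subring_set_0[OF B] ideal_set_0[OF Pi] by simp
    show "1 \<notin> ?Q" using j0 by auto
    show "x + y \<in> ?Q" if "x \<in> ?Q" "y \<in> ?Q" for x y
      using that subring_set_add[OF B] ideal_set_add[OF Pi] by (simp add: distrib_right)
    show "s * x \<in> ?Q" if "s \<in> B" "x \<in> ?Q" for s x
    proof -
      have "s * x * j \<in> P" if "j \<in> J" for j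
      proof -
        have "x * (s * j) \<in> P" using \<open>x \<in> ?Q\<close> ideal_set_mult[OF J(2) \<open>s \<in> B\<close> that] by blast
        then show ?thesis by (simp add: mult_ac)
      qed
      then show ?thesis using that subring_set_mult[OF B] by blast
    qed
    show "x \<in> ?Q \<or> y \<in> ?Q" if xy: "x \<in> B" "y \<in> B" "x * y \<in> ?Q" for x y
    proof (rule ccontr)
      assume "\<not> (x \<in> ?Q \<or> y \<in> ?Q)"
      then obtain j k where jk: "j \<in> J" "k \<in> J" "x * j \<notin> P" "y * k \<notin> P" using xy(1,2) by blast
      have A': "x * j \<in> A" "y * k \<in> A"
        using xy jk ideal_set_mult[OF J(2)] ideal_set_subset[OF J(1)] by blast+
      have "j * k \<in> J" using jk ideal_set_mult[OF J(1)] ideal_set_subset[OF J(1)] by blast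
      then have "x * y * (j * k) \<in> P" using xy(3) by blast
      moreover have "x * y * (j * k) = (x * j) * (y * k)" by (simp add: mult_ac)
      ultimately have "(x * j) * (y * k) \<in> P" by simp
      then show False using prime_set_mult[OF P(1) A'] jk by blast
    qed
  qed
qed

text \<open>By \<open>max\<close> only the top member of a chain can contain \<open>J\<close>; all
  others lift. It remains to find a prime of \<open>B\<close> strictly above the last lift
  \<open>Q m\<close>.\<close>

lemma krull_dim_shared_ideal:
  fixes A B J :: "'a::field set"
  assumes A: "subring_set A" "A \<subseteq> B" and B: "subring_set B" and J: "ideal_set J A" "ideal_set J B"
    and max: "\<And>P Q. prime_set P A \<Longrightarrow> prime_set Q A \<Longrightarrow> J \<subseteq> P \<Longrightarrow> \<not> P \<subset> Q"
  shows "krull_dim (ring_on A) \<le> krull_dim (ring_on B)"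
proof (rule krull_dim_le[OF A(1)])
  fix n P assume P: "\<And>i. i \<le> n \<Longrightarrow> prime_set (P i) A" "\<And>i. i < n \<Longrightarrow> P i \<subset> P (Suc i)"
  show "enat n \<le> krull_dim (ring_on B)"
  proof (cases n)
    case 0
    then show ?thesis by (simp add: zero_enat_def[symmetric])
  next
    case (Suc m)
    define Q where "Q = (\<lambda>i. {x \<in> B. \<forall>j\<in>J. x * j \<in> P i})"
    have nJ: "\<not> J \<subseteq> P i" if "i < n" for i
      using max[of "P i" "P (Suc i)"] P that by auto
    have Q: "prime_set (Q i) B" "Q i \<inter> A = P i" if "i < n" for i
      unfolding Q_def using shared_ideal_lift[OF A B J _ nJ[OF that]] P(1)[of i] that by auto
    have mono: "Q i \<subset> Q (Suc i)" if "Suc i < n" for i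
    proof -
      have "P i \<subset> P (Suc i)" "Q i \<inter> A = P i" "Q (Suc i) \<inter> A = P (Suc i)"
        using Q(2) P(2) that by simp_all
      \<comment> \<open>The lift is monotone in the prime, and the different traces on
        \<open>A\<close> make the inclusion strict.\<close>
      moreover from this have "Q i \<subseteq> Q (Suc i)" unfolding Q_def by blast
      ultimately show ?thesis by blast
    qed
    have m: "m < n" using Suc by simp
    note Qm = Q(1)[OF m] and Qmi = prime_set_ideal[OF Q(1)[OF m]]
    have Pn: "prime_set (P n) A" "P m \<subset> P n" using P(1)[of n] P(2)[of m] Suc by auto
    \<comment> \<open>If \<open>Q m\<close> were maximal, it would be comaximal with \<open>J\<close>, since \<open>J\<close> is an ideal of \<open>B\<close> too.\<close>
    have "\<exists>M. prime_set M B \<and> Q m \<subset> M"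
    proof (cases "J \<subseteq> P n")
      case True
      define S where "S = {q + j | q j. q \<in> Q m \<and> j \<in> J}"
      have "ideal_set S B"
        unfolding ideal_set_def
      proof (intro conjI ballI)
        show "S \<subseteq> B"
          unfolding S_def using ideal_set_subset[OF Qmi] ideal_set_subset[OF J(2)]
          by (auto intro: subring_set_add[OF B])
        show "0 \<in> S" unfolding S_def using ideal_set_0[OF Qmi] ideal_set_0[OF J(2)] by force
        show "x + y \<in> S" if xy: "x \<in> S" "y \<in> S" for x y
        proof -
          obtain q j r k where *: "x = q + j" "y = r + k" "q \<in> Q m" "r \<in> Q m" "j \<in> J" "k \<in> J"
            using xy by (auto simp: S_def)
          have "x + y = (q + r) + (j + k)" using * by simp
          then show ?thesis
            unfolding S_def using * ideal_set_add[OF Qmi] ideal_set_add[OF J(2)] by blast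
        qed
        show "s * x \<in> S" if sx: "s \<in> B" "x \<in> S" for s x
        proof -
          obtain q j where *: "x = q + j" "q \<in> Q m" "j \<in> J" using sx by (auto simp: S_def)
          have "s * x = s * q + s * j" using * by (simp add: distrib_left)
          then show ?thesis
            unfolding S_def using * sx(1) ideal_set_mult[OF Qmi] ideal_set_mult[OF J(2)] by blast
        qed
      qed
      \<comment> \<open>If \<open>1 = q + j\<close>, then \<open>q = 1 - j\<close> lies in
        \<open>A\<close>, hence in \<open>Q m \<inter> A = P m\<close>; both summands would then be
        in the proper ideal \<open>P n\<close>.\<close>
      moreover have "1 \<notin> S"
      proof
        assume "1 \<in> S"
        then obtain q j where qj: "1 = q + j" "q \<in> Q m" "j \<in> J" by (auto simp: S_def)
        then have "q = 1 - j" by (simp add: algebra_simps)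
        then have "q \<in> A"
          using subring_set_diff[OF A(1) subring_set_1[OF A(1)]] ideal_set_subset[OF J(1)] qj(3) by simp
        then have "q \<in> P n" using Q(2)[OF m] qj(2) Pn(2) by blast
        moreover have "j \<in> P n" using True qj(3) by blast
        ultimately have "1 \<in> P n"
          unfolding qj(1) by (rule ideal_set_add[OF prime_set_ideal[OF Pn(1)]])
        then show False using prime_set_1[OF Pn(1)] by simp
      qed
      ultimately obtain M where M: "prime_set M B" "S \<subseteq> M" using exists_prime_set[OF B] by blast
      have sub: "Q m \<subseteq> S" "J \<subseteq> S"
        unfolding S_def using ideal_set_0[OF Qmi] ideal_set_0[OF J(2)] by force+
      have "\<not> J \<subseteq> Q m" using Q(2)[OF m] nJ[OF m] ideal_set_subset[OF J(1)] by blast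
      then have "Q m \<subset> M" using sub M(2) by blast
      then show ?thesis using M(1) by blast
    next
      case False
      \<comment> \<open>Here \<open>P n\<close> does not contain \<open>J\<close>, so it lifts like
        the other members.\<close>
      define M where "M = {x \<in> B. \<forall>j\<in>J. x * j \<in> P n}"
      have M: "prime_set M B" "M \<inter> A = P n"
        unfolding M_def using shared_ideal_lift[OF A B J Pn(1) False] by auto
      moreover have "Q m \<subseteq> M" using Pn(2) unfolding M_def Q_def by auto
      ultimately show ?thesis using Pn(2) Q(2)[OF m] by blast
    qed
    then obtain M where M: "prime_set M B" "Q m \<subset> M" by blast
    define Q' where "Q' = Q(n := M)"
    have "prime_set (Q' i) B" if "i \<le> n" for i
      using that M(1) Q(1)[of i] by (auto simp: Q'_def le_less)
    moreover have "Q' i \<subset> Q' (Suc i)" if "i < n" for i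
    proof (cases "i = m")
      case True
      then show ?thesis using M(2) Suc by (simp add: Q'_def)
    next
      case False
      then show ?thesis using mono[of i] that Suc by (simp add: Q'_def)
    qed
    ultimately show ?thesis by (rule le_krull_dim[OF B])
  qed
qed

section \<open>Integer-valued rational functions\<close>

lemma int_rat_mono: "R \<subseteq> S \<Longrightarrow> int_rat E R \<subseteq> int_rat E S"
  unfolding int_rat_def by blast

lemma const_fract_value: "has_value (const_fract c) a c"
  using has_value_const[of c a] by (simp add: to_fract_def)

lemma const_fract_int_rat: "c \<in> R \<Longrightarrow> const_fract c \<in> int_rat E R"
  unfolding int_rat_def using const_fract_value by blast

lemma has_value_0: "has_value 0 a 0" and has_value_1: "has_value 1 a 1"
  using const_fract_value[of 0 a] const_fract_value[of 1 a] by (simp_all add: const_fract_hom)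

lemma has_value_diff: "has_value \<phi> a y \<Longrightarrow> has_value \<psi> a z \<Longrightarrow> has_value (\<phi> - \<psi>) a (y - z)"
  using has_value_add[of \<phi> a y "- \<psi>" "- z"] has_value_minus[of \<psi> a z] by simp

lemma has_value_power: "has_value \<phi> a y \<Longrightarrow> has_value (\<phi> ^ n) a (y ^ n)"
  by (induction n) (auto intro: has_value_mult has_value_1)

lemma has_value_prod:
  "(\<And>i. i \<in> S \<Longrightarrow> has_value (f i) a (g i)) \<Longrightarrow> has_value (prod f S) a (prod g S)"
  by (induction S rule: infinite_finite_induct) (auto intro: has_value_mult has_value_1)

lemma subring_set_int_rat:
  assumes "subring_set R"
  shows "subring_set (int_rat E R)"
  by (intro subring_set_of_subring subring_int_rat)
    (use assms in \<open>simp add: subring_set_iff_subdomain[symmetric] subdomain_def subcring_def\<close>)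

lemma ideal_set_int_rat:
  assumes "ideal_set I R"
  shows "ideal_set (int_rat E I) (int_rat E R)"
  unfolding ideal_set_def
proof (intro conjI ballI)
  show "int_rat E I \<subseteq> int_rat E R" using assms by (intro int_rat_mono) (auto simp: ideal_set_def)
  show "0 \<in> int_rat E I" unfolding int_rat_def using has_value_0 ideal_set_0[OF assms] by blast
  show "\<phi> + \<psi> \<in> int_rat E I" if "\<phi> \<in> int_rat E I" "\<psi> \<in> int_rat E I" for \<phi> \<psi>
    using that ideal_set_add[OF assms] has_value_add unfolding int_rat_def by blast
  show "\<phi> * \<psi> \<in> int_rat E I" if "\<phi> \<in> int_rat E R" "\<psi> \<in> int_rat E I" for \<phi> \<psi>
    using that ideal_set_mult[OF assms] has_value_mult unfolding int_rat_def by blast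
qed

section \<open>Maximality of the primes above the shared ideal\<close>

text \<open>Pigeonhole on the classes of \<open>y ^ 0\<close>, ..., \<open>y ^ N\<close> with
  \<open>N\<close> the cardinality of \<open>D/I\<close>. The bound is uniform in \<open>y\<close>,
  so that one finite product can serve for all points of \<open>E\<close>.\<close>

lemma finite_quotient_power:
  fixes I D :: "'a::comm_ring_1 set"
  assumes D: "subring_set D" and I: "ideal_set I D" and fin: "finite (carrier (ring_on D Quot I))"
  shows "\<exists>N. \<forall>y\<in>D. \<exists>a b. a < b \<and> b \<le> N \<and> y ^ a - y ^ b \<in> I"
proof (rule exI, rule ballI)
  let ?C = "carrier (ring_on D Quot I)"
  fix y assume y: "y \<in> D"
  define f where "f = (\<lambda>k::nat. I +>\<^bsub>ring_on D\<^esub> (y ^ k))"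
  have "f ` {..card ?C} \<subseteq> ?C"
    using y D by (auto simp: f_def FactRing_def A_RCOSETS_def' intro!: subring_set_power)
  then have "card (f ` {..card ?C}) \<le> card ?C" by (rule card_mono[OF fin])
  then have "\<not> inj_on f {..card ?C}" by (auto dest: card_image)
  then obtain k l where kl: "k \<noteq> l" "k \<le> card ?C" "l \<le> card ?C" "f k = f l"
    by (auto simp: inj_on_def)
  have *: "y ^ i - y ^ j \<in> I" if "f i = f j" for i j
  proof -
    have "y ^ i \<in> f i" using ideal_set_0[OF I] by (force simp: f_def a_r_coset_def')
    then have "y ^ i \<in> f j" using that by simp
    then show ?thesis by (auto simp: f_def a_r_coset_def')
  qed
  show "\<exists>a b. a < b \<and> b \<le> card ?C \<and> y ^ a - y ^ b \<in> I"
    using kl *[of k l] *[of l k] by (cases "k < l") (auto simp: not_less le_less)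
qed

text \<open>By the pigeonhole principle in \<open>D/I\<close>, the product of all \<open>\<phi>^a - \<phi>^b\<close> with \<open>a < b \<le> N\<close> takes
  values in \<open>I\<close>, so one of its factors lies in \<open>P\<close>.\<close>

lemma int_rat_prime_maximal:
  assumes D: "subring_set D" and I: "ideal_set I D" and fin: "finite (carrier (ring_on D Quot I))"
    and P: "prime_set P (int_rat E D)" and Q: "prime_set Q (int_rat E D)" and sub: "int_rat E I \<subseteq> P"
  shows "\<not> P \<subset> Q"
proof
  assume PQ: "P \<subset> Q"
  note S = subring_set_int_rat[OF D, of E]
  note Qi = prime_set_ideal[OF Q]
  obtain \<phi> where \<phi>: "\<phi> \<in> Q" "\<phi> \<notin> P" using PQ by blast
  have \<phi>D: "\<phi> \<in> int_rat E D" using ideal_set_subset[OF Qi \<phi>(1)] .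
  obtain N where N: "\<forall>y\<in>D. \<exists>a b. a < b \<and> b \<le> N \<and> y ^ a - y ^ b \<in> I"
    using finite_quotient_power[OF D I fin] by blast
  define T where "T = {(a, b). a < b \<and> b \<le> N}"
  have T: "finite T" by (rule finite_subset[of _ "{..N} \<times> {..N}"]) (auto simp: T_def)
  define f where "f = (\<lambda>(a, b). \<phi> ^ a - \<phi> ^ b)"
  have fS: "f i \<in> int_rat E D" for i
    using S \<phi>D by (auto simp: f_def split: prod.split intro: subring_set_diff subring_set_power)
  have "prod f T \<in> int_rat E I"
    unfolding int_rat_def
  proof (intro CollectI ballI)
    fix e assume "e \<in> E"
    then obtain y where y: "y \<in> D" "has_value \<phi> e y" using \<phi>D by (auto simp: int_rat_def)
    define g where "g = (\<lambda>(a, b). y ^ a - y ^ b)"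
    have "has_value (prod f T) e (prod g T)"
      by (rule has_value_prod)
        (auto simp: f_def g_def intro: has_value_diff has_value_power y)
    moreover obtain i where "i \<in> T" "g i \<in> I" using N y(1) by (fastforce simp: T_def g_def)
    then have "prod g T \<in> I"
      using y(1) D by (intro ideal_set_prod[OF D I T])
        (auto simp: g_def split: prod.split intro: subring_set_diff subring_set_power)
    ultimately show "\<exists>z\<in>I. has_value (prod f T) e z" by blast
  qed
  then have "\<exists>i\<in>T. f i \<in> P" using prime_set_prod[OF S P T, of f] fS sub by blast
  then obtain a b where ab: "a < b" "\<phi> ^ a - \<phi> ^ b \<in> P"
    by (auto simp: T_def f_def)
  \<comment> \<open>As \<open>P\<close> is prime, the factor \<open>\<phi> ^ a\<close> cancels and
    \<open>1 - \<phi> ^ (b - a)\<close> is in \<open>P\<close>. Since \<open>\<phi>\<close> is in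
    \<open>Q\<close> and \<open>b - a\<close> is positive, this puts 1 into
    \<open>Q\<close>.\<close>
  have "\<phi> ^ k \<notin> P" for k
    using \<phi>(2) prime_set_1[OF P] prime_set_mult[OF P \<phi>D] subring_set_power[OF S \<phi>D]
    by (induction k) auto
  moreover have "\<phi> ^ a * (1 - \<phi> ^ (b - a)) \<in> P"
    using ab by (simp add: algebra_simps flip: power_add)
  ultimately have "1 - \<phi> ^ (b - a) \<in> P"
    using prime_set_mult[OF P subring_set_power[OF S \<phi>D]
        subring_set_diff[OF S subring_set_1[OF S] subring_set_power[OF S \<phi>D]]] by blast
  moreover have "\<phi> ^ (b - a) = \<phi> * \<phi> ^ (b - a - 1)"
    using ab(1) by (simp flip: power_Suc add: Suc_diff_Suc)
  then have "\<phi> ^ (b - a) \<in> Q"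
    using ideal_set_mult'[OF Qi subring_set_power[OF S \<phi>D] \<phi>(1)] by simp
  ultimately have "1 \<in> Q" using ideal_set_add[OF Qi, of "1 - \<phi> ^ (b - a)" "\<phi> ^ (b - a)"] PQ by auto
  then show False using prime_set_1[OF Q] by blast
qed

section \<open>Lower bound by evaluation at a point\<close>

lemma prime_set_zero: "subring_set R \<Longrightarrow> prime_set {0} (R :: 'a::idom set)"
  by (auto simp: prime_set_def ideal_set_def subring_set_closed)

text \<open>The kernel of the evaluation at \<open>e\<close> is nonzero, as it contains \<open>\<pi> = d (X - e)\<close>.\<close>

lemma krull_dim_int_rat_ge:
  fixes D E :: "'k::field set"
  assumes D: "subring_set D" and e: "e \<in> E" and frac: "fractional_subset E D"
  shows "1 + krull_dim (ring_on D) \<le> krull_dim (ring_on (int_rat E D))"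
proof -
  note S = subring_set_int_rat[OF D, of E]
  \<comment> \<open>The preimage of \<open>P\<close> under evaluation at \<open>e\<close>.
    Evaluation is available only as the relation \<open>has_value\<close>, whose totality on this
    ring is \<open>vals\<close> and whose uniqueness is \<open>has_value_unique\<close>.\<close>
  define pull where "pull = (\<lambda>P. {\<phi> \<in> int_rat E D. \<exists>y\<in>P. has_value \<phi> e y})"
  have pullI: "\<phi> \<in> pull P" if "\<phi> \<in> int_rat E D" "has_value \<phi> e y" "y \<in> P" for \<phi> y P
    using that by (auto simp: pull_def)
  have vals: "\<exists>y\<in>D. has_value \<phi> e y" if "\<phi> \<in> int_rat E D" for \<phi>
    using that e by (auto simp: int_rat_def)
  have pull: "prime_set (pull P) (int_rat E D)" if P: "prime_set P D" for P
    unfolding prime_set_def ideal_set_def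
  proof (intro conjI ballI impI)
    note Pi = prime_set_ideal[OF P]
    show "pull P \<subseteq> int_rat E D" by (auto simp: pull_def)
    show "0 \<in> pull P"
      using has_value_0 ideal_set_0[OF Pi] subring_set_0[OF S] by (auto simp: pull_def)
    show "1 \<notin> pull P"
      using has_value_unique[OF has_value_1] prime_set_1[OF P] by (auto simp: pull_def)
    show "\<phi> + \<psi> \<in> pull P" if *: "\<phi> \<in> pull P" "\<psi> \<in> pull P" for \<phi> \<psi>
    proof -
      obtain x y where "x \<in> P" "has_value \<phi> e x" "\<phi> \<in> int_rat E D"
          "y \<in> P" "has_value \<psi> e y" "\<psi> \<in> int_rat E D"
        using * by (auto simp: pull_def)
      then show ?thesis
        by (intro pullI[OF subring_set_add[OF S] has_value_add] ideal_set_add[OF Pi])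
    qed
    show "\<phi> * \<psi> \<in> pull P" if *: "\<phi> \<in> int_rat E D" "\<psi> \<in> pull P" for \<phi> \<psi>
    proof -
      obtain x y where "x \<in> D" "has_value \<phi> e x" "y \<in> P" "has_value \<psi> e y" "\<psi> \<in> int_rat E D"
        using vals[OF *(1)] *(2) by (auto simp: pull_def)
      then show ?thesis
        using *(1) by (intro pullI[OF subring_set_mult[OF S] has_value_mult] ideal_set_mult[OF Pi])
    qed
    show "\<phi> \<in> pull P \<or> \<psi> \<in> pull P"
      if *: "\<phi> \<in> int_rat E D" "\<psi> \<in> int_rat E D" "\<phi> * \<psi> \<in> pull P" for \<phi> \<psi>
    proof -
      obtain x y z where xyz: "x \<in> D" "has_value \<phi> e x" "y \<in> D" "has_value \<psi> e y"
          "z \<in> P" "has_value (\<phi> * \<psi>) e z"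
        using vals[OF *(1)] vals[OF *(2)] *(3) unfolding pull_def by blast
      then have "x * y \<in> P" using has_value_unique[OF has_value_mult[OF xyz(2,4)] xyz(6)] by simp
      then have "x \<in> P \<or> y \<in> P" using xyz prime_set_mult[OF P] by blast
      then show ?thesis using * xyz unfolding pull_def by blast
    qed
  qed
  \<comment> \<open>Evaluation at \<open>e\<close> is onto \<open>D\<close>, the constants being
    preimages, so distinct primes have distinct preimages.\<close>
  have strict: "pull P \<subset> pull P'" if P: "P \<subset> P'" "prime_set P' D" for P P'
  proof -
    obtain c where c: "c \<in> P'" "c \<notin> P" using P(1) by blast
    then have "c \<in> D" using P(2) by (auto dest: prime_set_ideal ideal_set_subset)
    then have "const_fract c \<in> pull P'"
      using c const_fract_value const_fract_int_rat unfolding pull_def by blast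
    moreover have "const_fract c \<notin> pull P"
      using c has_value_unique[OF const_fract_value] unfolding pull_def by blast
    ultimately show ?thesis using P(1) unfolding pull_def by blast
  qed
  obtain d where d: "d \<in> D" "d \<noteq> 0" "\<And>a. a \<in> E \<Longrightarrow> d * a \<in> D"
    using frac by (auto simp: fractional_subset_def)
  define \<pi> where "\<pi> = Fract [:- (d * e), d:] 1"
  have \<pi>: "has_value \<pi> a (d * a - d * e)" for a
    unfolding has_value_def \<pi>_def by (intro exI[of _ "[:- (d * e), d:]"] exI[of _ 1]) (simp add: mult.commute)
  have \<pi>0: "\<pi> \<noteq> 0" using d(2) by (simp add: \<pi>_def Zero_fract_def eq_fract)
  have "\<pi> \<in> int_rat E D"
    unfolding int_rat_def using \<pi> d(3) e subring_set_diff[OF D] by blast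
  then have "\<pi> \<in> pull P" if "prime_set P D" for P
    using \<pi>[of e] ideal_set_0[OF prime_set_ideal[OF that]] unfolding pull_def by auto
  then have pull0: "{0} \<subset> pull P" if "prime_set P D" for P
    using that \<pi>0 ideal_set_0[OF prime_set_ideal[OF pull[OF that]]] by blast
  have chain: "enat (Suc n) \<le> krull_dim (ring_on (int_rat E D))"
    if P: "\<And>i. i \<le> n \<Longrightarrow> prime_set (P i) D" "\<And>i. i < n \<Longrightarrow> P i \<subset> P (Suc i)" for n P
  proof (rule le_krull_dim[OF S])
    \<comment> \<open>The pulled-back chain is shifted up by one place to make room for the zero
      ideal.\<close>
    define Q where "Q = (\<lambda>i. case i of 0 \<Rightarrow> {0} | Suc k \<Rightarrow> pull (P k))"
    show "prime_set (Q i) (int_rat E D)" if "i \<le> Suc n" for i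
      using that P(1) by (auto simp: Q_def prime_set_zero[OF S] pull split: nat.split)
    show "Q i \<subset> Q (Suc i)" if "i < Suc n" for i
      using that P pull0[OF P(1)] strict[OF P(2) P(1)]
      by (cases i) (simp_all add: Q_def)
  qed
  show ?thesis
  proof (cases "krull_dim (ring_on (int_rat E D))")
    case (enat m)
    \<comment> \<open>The chain consisting of the zero ideal of \<open>D\<close> alone shows that
      \<open>m\<close> is positive, so one can be subtracted from it.\<close>
    have "enat (Suc 0) \<le> enat m"
      using chain[of 0 "\<lambda>_. {0}"] prime_set_zero[OF D] enat by simp
    then obtain k where k: "m = Suc k" by (cases m) auto
    have "krull_dim (ring_on D) \<le> enat k"
      by (rule krull_dim_le[OF D]) (use chain enat k in fastforce)
    then have "1 + krull_dim (ring_on D) \<le> 1 + enat k" by (rule add_left_mono)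
    then show ?thesis using enat k by (simp add: one_enat_def)
  qed simp
qed

theorem theorem1p17:
  fixes D B I E :: "'k::field set"
  assumes "subdomain D ring_of_type_algebra"
    and "subdomain B ring_of_type_algebra"
    and "D \<subset> B"
    and "quotient_field D = UNIV"
    and "quotient_field B = UNIV"
    and "ideal I (ring_on D)"
    and "ideal I (ring_on B)"
    and "I \<noteq> {0}"
    and "E \<noteq> {}"
    and "finite (carrier (ring_on D Quot I))"
  shows "krull_dim (ring_on (int_rat E D)) \<le> krull_dim (ring_on (int_rat E B)) \<and>
    (fractional_subset E D \<and> E \<subseteq> B \<longrightarrow>
       1 + krull_dim (ring_on D) \<le> krull_dim (ring_on (int_rat E D)) \<and>
       krull_dim (ring_on (int_rat E D)) \<le> 1 + valuative_dim B)"
proof -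
  have D: "subring_set D" and B: "subring_set B"
    using assms(1,2) by (simp_all add: subring_set_iff_subdomain)
  have I: "ideal_set I D" "ideal_set I B"
    using assms(6,7) by (simp_all add: ideal_set_iff D B)
  have le: "krull_dim (ring_on (int_rat E D)) \<le> krull_dim (ring_on (int_rat E B))"
    using assms(3) int_rat_prime_maximal[OF D I(1) assms(10)]
    by (intro krull_dim_shared_ideal[OF _ _ _ I[THEN ideal_set_int_rat]])
      (auto intro!: int_rat_mono subring_set_int_rat D B)
  obtain e where e: "e \<in> E" using assms(9) by blast
  \<comment> \<open>The upper bound is proved for \<open>int_rat E B\<close>, which contains the
    constants from \<open>B\<close>, and passes to \<open>int_rat E D\<close> through
    \<open>le\<close>.\<close>
  have "krull_dim (ring_on (int_rat E B)) \<le> 1 + valuative_dim B"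
    using assms(5) by (intro krull_dim_le_valuative_dim subring_set_int_rat B)
      (auto intro: const_fract_int_rat)
  then show ?thesis using le krull_dim_int_rat_ge[OF D e] by (auto intro: order.trans)
qed

end
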